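(* Let $q_1,q_2<q^*$. Assume that: (i) $V_1\in C^1(0,\infty)$ and $V_1'$ is regularly varying at zero in the sense that $\displaystyle\lim_{y\to0}\frac{V_1'(xy)}{V_1'(y)}=x^{q_1-1}$ for all $x>0$; (ii) $V_2\in C^2(0,\infty)$, $\displaystyle\lim_{y\to0}\Big(-\frac{yV_2''(y)}{V_2'(y)}\Big)=1-q_2$, and there are constants $\bar q\in(\max\{q_1,q_2,0\},1)$ and $K>0$ such that $yV_2''(y)\le K\,y^{\bar q-1}$ for all $y\ge1$; (iii) if $q_1=q_2$, then $\displaystyle\lim_{y\to0}\frac{V_2'(y)}{V_1'(y)}=k$ for some $k\in[0,\infty]$. Then for every $x>0$, $$\lim_{t\to\infty}A(x,t)=\frac{\theta}{\sigma}\,(1-\min\{q_1,q_2\})\,x .$$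
   Context: Market and problem. Let $r>0$ (riskless rate), $\delta>0$ (discount rate), $\mu>0$, $\sigma>0$ be constants, $\theta=\sigma^{-1}(\mu-r)\neq0$ (Sharpe ratio), and $W$ a standard Brownian motion. Wealth satisfies $dX_s=rX_s\,ds+X_s\pi_s\sigma(\theta\,ds+dW_s)-c_s\,ds$, where $\pi_s$ is the proportion of wealth in the risky asset and $c_s\ge0$ is the consumption rate. The agent maximizes $E\big[\int_0^T e^{-\delta s}U_2(c_s)\,ds+e^{-\delta T}U_1(X_T)\big]$ over $(\pi,c)$. The variable $t$ denotes the time horizon (time remaining to the terminal date), so the distant-horizon limit is $t\to\infty$. Standing assumptions on utilities, $i=1,2$: $U_i$ is continuously differentiable, strictly increasing and strictly concave on $(0,\infty)$, $U_i(0)=0$, $U_i'(0)=\infty$, $U_i'(\infty)=0$, and $U_i(x)\le C_0(1+x^p)$ for $x\ge0$ and some constants $C_0>0$, $0<p<1$. The dual functions are $V_i(y)=\sup_{x\ge0}\{U_i(x)-xy\}$, $y>0$. Constants: $\alpha=\frac12+\frac{r-\delta}{\theta^2}$, $a=\frac{\theta}{\sqrt2}$, $\beta=-a^2\alpha^2-\delta$. The threshold is $q^*=\alpha-\sqrt{\alpha^2+2\delta/\theta^2}<0$. Optimal strategies. For $y>0$, $t>0$ (with $\pi$ in the next formula the number $3.14\ldots$) let $$I_i(y,t)=\frac{e^{\beta t}}{2\sqrt{\pi}}\int_{-\infty}^\infty e^{-\frac{\eta^2}{4}-(\alpha-1)a\sqrt t\,\eta}\,\big|V_i'(ye^{a\sqrt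 t\,\eta})\big|\,d\eta,\qquad v_y(y,t)=-I_1(y,t)-\int_0^tI_2(y,\tau)\,d\tau .$$ For $x>0$, $t>0$, let $y=y(x,t)>0$ be the unique solution of $x=-v_y(y,t)$. The optimal amount of money in the risky asset at wealth $x$ with horizon $t$ is $$A(x,t)=\frac{\theta}{\sigma}\,y\,v_{yy}(y,t),\qquad y=y(x,t),$$ where $v_{yy}=\partial_y v_y$. *)

theory Defs
  imports "HOL-Analysis.Analysis"
begin

definition strictly_concave_on :: "real set \<Rightarrow> (real \<Rightarrow> real) \<Rightarrow> bool" where
  "strictly_concave_on S U \<longleftrightarrow> convex S \<and>
     (\<forall>x\<in>S. \<forall>y\<in>S. \<forall>u. x \<noteq> y \<and> 0 < u \<and> u < 1 \<longrightarrow>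
        u * U x + (1 - u) * U y < U (u * x + (1 - u) * y))"

text \<open>Utilities live on the closed half line; the values of a utility at negative arguments
  are irrelevant.\<close>

definition utility :: "(real \<Rightarrow> real) \<Rightarrow> bool" where
  "utility U \<longleftrightarrow>
     U C1_differentiable_on {0<..} \<and>
     strict_mono_on {0<..} U \<and>
     strictly_concave_on {0<..} U \<and>
     U 0 = 0 \<and>
     filterlim (deriv U) at_top (at_right 0) \<and>
     (deriv U \<longlongrightarrow> 0) at_top \<and>
     (\<exists>C p. C > 0 \<and> 0 < p \<and> p < 1 \<and> (\<forall>x\<ge>0. U x \<le> C * (1 + x powr p)))"

definition dual_fun :: "(real \<Rightarrow> real) \<Rightarrow> real \<Rightarrow> real" where
  "dual_fun U y = (SUP x\<in>{0..}. U x - x * y)"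

definition sharpe :: "real \<Rightarrow> real \<Rightarrow> real \<Rightarrow> real" where
  "sharpe r \<mu> \<sigma> = (\<mu> - r) / \<sigma>"

text \<open>In the following, \<open>\<theta>\<close> is the Sharpe ratio, \<open>r\<close> the riskless rate and \<open>\<delta>\<close> the discount rate.\<close>

definition alpha_const :: "real \<Rightarrow> real \<Rightarrow> real \<Rightarrow> real" where
  "alpha_const r \<delta> \<theta> = 1 / 2 + (r - \<delta>) / \<theta>\<^sup>2"

definition a_const :: "real \<Rightarrow> real" where
  "a_const \<theta> = \<theta> / sqrt 2"

definition beta_const :: "real \<Rightarrow> real \<Rightarrow> real \<Rightarrow> real" where
  "beta_const r \<delta> \<theta> = - ((a_const \<theta>)\<^sup>2 * (alpha_const r \<delta> \<theta>)\<^sup>2) - \<delta>"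

definition q_star :: "real \<Rightarrow> real \<Rightarrow> real \<Rightarrow> real" where
  "q_star r \<delta> \<theta> = alpha_const r \<delta> \<theta> - sqrt ((alpha_const r \<delta> \<theta>)\<^sup>2 + 2 * \<delta> / \<theta>\<^sup>2)"

text \<open>\<open>I_fun r \<delta> \<theta> V y t\<close> is the function \<open>I\<^sub>i(y,t)\<close> belonging to the dual function \<open>V = V\<^sub>i\<close>.\<close>

definition I_fun :: "real \<Rightarrow> real \<Rightarrow> real \<Rightarrow> (real \<Rightarrow> real) \<Rightarrow> real \<Rightarrow> real \<Rightarrow> real" where
  "I_fun r \<delta> \<theta> V y t =
     exp (beta_const r \<delta> \<theta> * t) / (2 * sqrt pi) *
     (LBINT \<eta>. exp (- (\<eta>\<^sup>2 / 4) - (alpha_const r \<delta> \<theta> - 1) * a_const \<theta> * sqrt t * \<eta>) *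
               \<bar>deriv V (y * exp (a_const \<theta> * sqrt t * \<eta>))\<bar>)"

definition v_y ::
  "real \<Rightarrow> real \<Rightarrow> real \<Rightarrow> (real \<Rightarrow> real) \<Rightarrow> (real \<Rightarrow> real) \<Rightarrow> real \<Rightarrow> real \<Rightarrow> real" where
  "v_y r \<delta> \<theta> V1 V2 y t =
     - I_fun r \<delta> \<theta> V1 y t - (LBINT \<tau>:{0..t}. I_fun r \<delta> \<theta> V2 y \<tau>)"

definition v_yy ::
  "real \<Rightarrow> real \<Rightarrow> real \<Rightarrow> (real \<Rightarrow> real) \<Rightarrow> (real \<Rightarrow> real) \<Rightarrow> real \<Rightarrow> real \<Rightarrow> real" where
  "v_yy r \<delta> \<theta> V1 V2 y t = deriv (\<lambda>z. v_y r \<delta> \<theta> V1 V2 z t) y"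

definition y_sol ::
  "real \<Rightarrow> real \<Rightarrow> real \<Rightarrow> (real \<Rightarrow> real) \<Rightarrow> (real \<Rightarrow> real) \<Rightarrow> real \<Rightarrow> real \<Rightarrow> real" where
  "y_sol r \<delta> \<theta> V1 V2 x t = (THE y. y > 0 \<and> x = - v_y r \<delta> \<theta> V1 V2 y t)"

text \<open>Optimal amount of money in the risky asset at wealth \<open>x\<close> with time \<open>t\<close> remaining, for
  consumption utility \<open>U2\<close> and terminal utility \<open>U1\<close>.\<close>

definition risky_amount ::
  "real \<Rightarrow> real \<Rightarrow> real \<Rightarrow> real \<Rightarrow> (real \<Rightarrow> real) \<Rightarrow> (real \<Rightarrow> real) \<Rightarrow> real \<Rightarrow> real \<Rightarrow> real" where
  "risky_amount r \<delta> \<mu> \<sigma> U1 U2 x t =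
     (let \<theta> = sharpe r \<mu> \<sigma>; V1 = dual_fun U1; V2 = dual_fun U2;
          y = y_sol r \<delta> \<theta> V1 V2 x t
      in \<theta> / \<sigma> * y * v_yy r \<delta> \<theta> V1 V2 y t)"

end

theory Submission
  imports Defs "HOL-Probability.Distributions"
begin

text \<open>By convexity of \<open>V\<^sub>i\<close>, \<open>J\<^sub>i = \<bar>V\<^sub>i'\<bar>\<close> is decreasing. The Gaussian average
  defining \<open>I\<^sub>i\<close> maps \<open>z powr (q - 1)\<close> to \<open>y powr (q - 1) * exp (\<lambda>(q) t)\<close> with \<open>\<lambda>(q) > 0\<close> for \<open>q < q\<^sup>*\<close> and
  \<open>\<lambda>(q) < 0\<close> on \<open>[0, 1]\<close>. Hence the solution \<open>y(x,t)\<close> tends to infinity, and the parts of the integrals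
  in which the argument of \<open>J\<^sub>i\<close> stays away from 0 are negligible. On the rest the elasticity of
  \<open>V\<^sub>2'\<close> gives \<open>- y \<partial>\<^sub>y \<integral> I\<^sub>2 \<sim> (1 - q\<^sub>2) \<integral> I\<^sub>2\<close>. For \<open>I\<^sub>1\<close>, where no second derivative is available,
  the function \<open>u \<mapsto> exp (u\<^sup>2 / (4 a\<^sup>2 t) - (\<alpha> - 1) u) I\<^sub>1(exp u, t)\<close> is a Laplace transform in \<open>u\<close>, so \<open>ln I\<^sub>1\<close> is
  asymptotically convex in \<open>ln y\<close>; difference quotients, which regular variation controls, therefore
  bound the derivative, and \<open>- y \<partial>\<^sub>y I\<^sub>1 \<sim> (1 - q\<^sub>1) I\<^sub>1\<close>. Finally \<open>I\<^sub>1 + \<integral> I\<^sub>2 = x\<close>, and the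
  summand with the larger exponent vanishes because \<open>\<lambda>(q) / (1 - q)\<close> is strictly decreasing.\<close>

section \<open>Analytic preliminaries\<close>

text \<open>Wealth stays fixed while the horizon grows, and one of the two summands of
  \<open>x\<close> may vanish. The asymptotic statements are therefore additive: a difference tends
  to 0, with errors measured against \<open>x\<close>. The averaging is linear and monotone, so
  information about the marginals at 0 is first turned into inequalities valid for all
  \<open>z > 0\<close>, with a remainder for the region away from 0. The form of that remainder is
  decisive. In the terminal part a constant is averaged to a multiple of
  \<open>exp (- r * t)\<close> and disappears. Its time integral, however, stays of order one, which
  suffices for the boundedness drawn from the lower bounds but not for a limit. For consumption the
  growth condition on the second derivative of \<open>V2\<close> supplies a remainder
  \<open>z powr (s - 1)\<close> with \<open>0 < s < 1\<close>; its time integral is at most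
  \<open>y powr (s - 1) / (- growth s)\<close>, which vanishes as \<open>y\<close> grows. Uniqueness
  of \<open>y(x,t)\<close> is itself a consequence of the limit theory, so that theory cannot start
  from a chosen solution; it is developed along an arbitrary filter carrying horizons and
  solutions.\<close>

lemma has_real_derivative_lebesgue_integral:
  fixes f f' :: "real \<Rightarrow> 'a \<Rightarrow> real"
  assumes S: "open S" "convex S" "x0 \<in> S"
    and int: "\<And>x. x \<in> S \<Longrightarrow> integrable M (f x)"
    and der: "\<And>x w. x \<in> S \<Longrightarrow> w \<in> space M \<Longrightarrow> ((\<lambda>x. f x w) has_real_derivative f' x w) (at x)"
    and bound: "\<And>x w. x \<in> S \<Longrightarrow> w \<in> space M \<Longrightarrow> \<bar>f' x w\<bar> \<le> g w"
    and g: "integrable M g"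
  shows "((\<lambda>x. \<integral>w. f x w \<partial>M) has_real_derivative (\<integral>w. f' x0 w \<partial>M)) (at x0)"
proof -
  define Q where "Q x w = (f x w - f x0 w) / (x - x0)" for x w
  have intQ: "integrable M (Q x)" if "x \<in> S" for x
    unfolding Q_def using int[OF that] int[OF S(3)] by (intro integrable_divide Bochner_Integration.integrable_diff)
  have Qb: "\<bar>Q x w\<bar> \<le> g w" if x: "x \<in> S" "x \<noteq> x0" and w: "w \<in> space M" for x w
  proof -
    \<comment> \<open>The mean value inequality on the convex set \<open>S\<close> lets
      \<open>g\<close> dominate the difference quotients as well as the derivatives.\<close>
    have "norm (f x w - f x0 w) \<le> g w * norm (x - x0)"
      by (rule field_differentiable_bound[OF S(2), where f = "\<lambda>x. f x w" and f' = "\<lambda>x. f' x w"])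
        (use x S w der bound in \<open>auto intro: has_field_derivative_at_within\<close>)
    thus ?thesis using x by (simp add: Q_def abs_divide divide_le_eq)
  qed
  have key: "(\<lambda>n. \<integral>w. Q (X n) w \<partial>M) \<longlonglongrightarrow> (\<integral>w. f' x0 w \<partial>M)"
    if XS: "\<And>n. X n \<in> S" "\<And>n. X n \<noteq> x0" and X: "X \<longlonglongrightarrow> x0" for X
  proof -
    have lim: "(\<lambda>n. Q (X n) w) \<longlonglongrightarrow> f' x0 w" if w: "w \<in> space M" for w
    proof -
      have "((\<lambda>x. Q x w) \<longlongrightarrow> f' x0 w) (at x0)"
        using der[OF S(3) w] unfolding has_field_derivative_iff Q_def .
      moreover have "filterlim X (at x0) sequentially"
        using X XS(2) by (simp add: filterlim_at)
      ultimately show ?thesis by (rule filterlim_compose)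
    qed
    \<comment> \<open>Measurability of the derivative is inherited from the difference quotients, of
      which it is the pointwise limit.\<close>
    have meas: "f' x0 \<in> borel_measurable M"
      by (rule borel_measurable_LIMSEQ_real[where u = "\<lambda>n. Q (X n)"])
        (use lim intQ XS in auto)
    show ?thesis
      by (rule integral_dominated_convergence[where w = g])
        (use meas lim intQ XS Qb g in auto)
  qed
  show ?thesis
    unfolding has_field_derivative_iff tendsto_at_iff_sequentially comp_def
  proof (intro allI impI)
    fix X :: "nat \<Rightarrow> real" assume X: "\<forall>i. X i \<in> UNIV - {x0}" "X \<longlonglongrightarrow> x0"
    from topological_tendstoD[OF X(2) S(1) S(3)]
    obtain N where N: "\<And>n. n \<ge> N \<Longrightarrow> X n \<in> S" by (auto simp: eventually_sequentially)
    have "(\<lambda>n. \<integral>w. Q (X (n + N)) w \<partial>M) \<longlonglongrightarrow> (\<integral>w. f' x0 w \<partial>M)"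
      by (rule key) (use N X LIMSEQ_ignore_initial_segment[OF X(2)] in auto)
    hence "(\<lambda>n. \<integral>w. Q (X n) w \<partial>M) \<longlonglongrightarrow> (\<integral>w. f' x0 w \<partial>M)"
      by (rule LIMSEQ_offset)
    moreover have "\<forall>\<^sub>F n in sequentially. (\<integral>w. Q (X n) w \<partial>M) =
        ((\<integral>w. f (X n) w \<partial>M) - (\<integral>w. f x0 w \<partial>M)) / (X n - x0)"
      using N int S(3) by (auto simp: eventually_sequentially Q_def intro!: exI[of _ N])
    ultimately show "(\<lambda>n. ((\<integral>w. f (X n) w \<partial>M) - (\<integral>w. f x0 w \<partial>M)) / (X n - x0))
        \<longlonglongrightarrow> (\<integral>w. f' x0 w \<partial>M)"
      by (rule Lim_transform_eventually)
  qed
qed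

text \<open>Completing the square: the integrand is a multiple of the normal density with mean
  \<open>2 * b\<close> and variance 2.\<close>

lemma gaussian_exp_linear:
  fixes b :: real
  shows "integrable lborel (\<lambda>\<eta>. exp (- (\<eta>\<^sup>2 / 4) + b * \<eta>))"
    and "(LBINT \<eta>. exp (- (\<eta>\<^sup>2 / 4) + b * \<eta>)) = 2 * sqrt pi * exp (b\<^sup>2)"
proof -
  have eq: "exp (- (\<eta>\<^sup>2 / 4) + b * \<eta>) = 2 * sqrt pi * exp (b\<^sup>2) * normal_density (2 * b) (sqrt 2) \<eta>" for \<eta>
  proof -
    have "exp (- (\<eta>\<^sup>2 / 4) + b * \<eta>) = exp (b\<^sup>2) * exp (- (\<eta> - 2 * b)\<^sup>2 / 4)"
      by (simp add: exp_add[symmetric] power2_eq_square field_simps)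
    moreover have "sqrt (2 * pi * (sqrt 2)\<^sup>2) = 2 * sqrt pi"
      by (simp add: real_sqrt_mult)
    ultimately show ?thesis by (simp add: normal_density_def)
  qed
  show "integrable lborel (\<lambda>\<eta>. exp (- (\<eta>\<^sup>2 / 4) + b * \<eta>))"
    unfolding eq by (intro integrable_mult_right) auto
  show "(LBINT \<eta>. exp (- (\<eta>\<^sup>2 / 4) + b * \<eta>)) = 2 * sqrt pi * exp (b\<^sup>2)"
    unfolding eq by (subst integral_mult_right_zero) auto
qed

lemma set_integral_exp:
  fixes c t :: real assumes "c \<noteq> 0" "t \<ge> 0"
  shows "set_integrable lborel {0..t} (\<lambda>\<tau>. exp (c * \<tau>))"
    and "(LBINT \<tau>:{0..t}. exp (c * \<tau>)) = (exp (c * t) - 1) / c"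
proof -
  show "set_integrable lborel {0..t} (\<lambda>\<tau>. exp (c * \<tau>))"
    by (rule borel_integrable_atLeastAtMost') (auto intro!: continuous_intros)
  have "(LBINT \<tau>:{0..t}. exp (c * \<tau>)) = exp (c * t) / c - exp (c * 0) / c"
    unfolding set_lebesgue_integral_def
    by (rule integral_FTC_atLeastAtMost[where F = "\<lambda>\<tau>. exp (c * \<tau>) / c"])
      (use assms in \<open>auto intro!: derivative_eq_intros continuous_intros
          simp: has_real_derivative_iff_has_vector_derivative[symmetric]\<close>)
  thus "(LBINT \<tau>:{0..t}. exp (c * \<tau>)) = (exp (c * t) - 1) / c"
    by (simp add: diff_divide_distrib)
qed

text \<open>Provides a majorant, uniform in \<open>h\<close>, for differentiating
  \<open>exp (h * l)\<close> in \<open>h\<close> under an integral that has all exponential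
  moments.\<close>

lemma abs_exp_le:
  fixes l h :: real
  assumes "\<bar>h\<bar> \<le> 1" shows "\<bar>l * exp (h * l)\<bar> \<le> exp (2 * l) + exp (- 2 * l)"
proof -
  have "\<bar>l\<bar> \<le> exp \<bar>l\<bar>" using exp_ge_add_one_self[of "\<bar>l\<bar>"] by linarith
  moreover have "h * l \<le> \<bar>l\<bar>"
    using assms mult_right_mono[of "\<bar>h\<bar>" 1 "\<bar>l\<bar>"] abs_ge_self[of "h * l"] by (simp add: abs_mult)
  ultimately have "\<bar>l\<bar> * exp (h * l) \<le> exp \<bar>l\<bar> * exp \<bar>l\<bar>" by (intro mult_mono) auto
  also have "\<dots> = exp (2 * \<bar>l\<bar>)" by (simp add: exp_add[symmetric])
  also have "\<dots> \<le> exp (2 * l) + exp (- 2 * l)" by (cases "l \<ge> 0") auto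
  finally show ?thesis by (simp add: abs_mult)
qed

lemma exp_decay:
  fixes c :: real assumes "c > 0" shows "((\<lambda>t. exp (- c * t)) \<longlongrightarrow> 0) at_top"
proof -
  have "filterlim (\<lambda>t. - c * t) at_bot at_top"
    by (rule filterlim_tendsto_neg_mult_at_bot[OF tendsto_const _ filterlim_ident]) (use assms in simp)
  thus ?thesis by (rule filterlim_compose[OF exp_at_bot])
qed

lemma powr_at_top:
  fixes c :: real assumes "c > 0" shows "filterlim (\<lambda>x. x powr c) at_top at_top"
proof -
  have "filterlim (\<lambda>x::real. exp (c * ln x)) at_top at_top"
    by (intro filterlim_compose[OF exp_at_top] filterlim_tendsto_pos_mult_at_top[OF tendsto_const assms] ln_at_top)
  moreover have "\<forall>\<^sub>F x::real in at_top. exp (c * ln x) \<le> x powr c"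
    using eventually_gt_at_top[of 0] by eventually_elim (simp add: powr_def)
  ultimately show ?thesis by (rule filterlim_at_top_mono)
qed

lemma C1_imp_deriv:
  fixes f :: "real \<Rightarrow> real"
  assumes "f C1_differentiable_on S"
  shows "\<And>x. x \<in> S \<Longrightarrow> (f has_real_derivative deriv f x) (at x)" and "continuous_on S (deriv f)"
proof -
  from assms obtain D where D: "\<And>x. x \<in> S \<Longrightarrow> (f has_real_derivative D x) (at x)" "continuous_on S D"
    unfolding C1_differentiable_on_def has_real_derivative_iff_has_vector_derivative by blast
  have eq: "deriv f x = D x" if "x \<in> S" for x using D(1)[OF that] by (rule DERIV_imp_deriv)
  show "(f has_real_derivative deriv f x) (at x)" if "x \<in> S" for x using D(1) eq that by simp
  show "continuous_on S (deriv f)" using D(2) eq by (simp cong: continuous_on_cong)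
qed

section \<open>Regular variation and elasticity\<close>

text \<open>Every point of \<open>(0, z0]\<close> is reached from the top shell
  \<open>[z0 / 2, z0]\<close> by finitely many halvings, and no halving increases
  \<open>g\<close>.\<close>

lemma dyadic_bound:
  fixes g :: "real \<Rightarrow> real"
  assumes step: "\<And>z. 0 < z \<Longrightarrow> z \<le> z0 \<Longrightarrow> g (z / 2) \<le> g z"
    and top: "\<And>z. z0 / 2 \<le> z \<Longrightarrow> z \<le> z0 \<Longrightarrow> g z \<le> M"
    and "0 < z" "z \<le> z0"
  shows "g z \<le> M"
proof -
  have *: "g z \<le> M" if "z0 / 2 ^ Suc n \<le> z" "0 < z" "z \<le> z0" for n z
    using that
  proof (induction n arbitrary: z)
    case 0 thus ?case by (intro top) auto
  next
    case (Suc n)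
    show ?case
    proof (cases "z0 / 2 \<le> z")
      case False
      have "g (2 * z) \<le> M" using Suc.prems False by (intro Suc.IH) (auto simp: field_simps)
      thus ?thesis using step[of "2 * z"] False Suc.prems by simp
    qed (use Suc.prems top in auto)
  qed
  have "z / z0 > 0" using assms by simp
  then obtain n where n: "(1 / 2) ^ n < z / z0" using real_arch_pow_inv[of "z / z0" "1 / 2"] by auto
  have "z0 / 2 ^ Suc n \<le> z0 / 2 ^ n" using assms by (intro divide_left_mono) auto
  also have "\<dots> \<le> z" using n assms by (simp add: field_simps power_one_over)
  finally show ?thesis using assms by (intro *) auto
qed

text \<open>Division by zero yields 0 in HOL, so a nonzero limit of the quotient excludes zeros of
  \<open>f\<close> near 0.\<close>

lemma ratio_limit_pos:
  fixes f :: "real \<Rightarrow> real"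
  assumes lim: "((\<lambda>y. g y / f y) \<longlongrightarrow> L) (at_right 0)" and "L \<noteq> 0"
    and nn: "\<And>z. 0 < z \<Longrightarrow> 0 \<le> f z"
  shows "\<forall>\<^sub>F y in at_right 0. f y > 0"
proof -
  have "\<forall>\<^sub>F y in at_right 0. g y / f y \<noteq> 0"
    using lim \<open>L \<noteq> 0\<close> by (rule tendsto_imp_eventually_ne)
  moreover have "\<forall>\<^sub>F y in at_right 0. (0::real) < y" by (rule eventually_at_right_less)
  ultimately show ?thesis
    by eventually_elim (use nn in \<open>force simp: less_le\<close>)
qed

lemma eventually_at_right_0_le:
  assumes "\<forall>\<^sub>F y in at_right (0::real). P y"
  obtains z0 where "z0 > 0" "\<And>z. 0 < z \<Longrightarrow> z \<le> z0 \<Longrightarrow> P z"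
proof -
  from assms obtain b where b: "b > 0" "\<And>y. 0 < y \<Longrightarrow> y < b \<Longrightarrow> P y"
    unfolding eventually_at_right_field by auto
  show ?thesis by (rule that[of "b / 2"]) (use b in auto)
qed

text \<open>Near 0 the limit gives the factor \<open>A\<close>; beyond a fixed \<open>z0\<close>
  monotonicity bounds the left side by a constant, which the averaging later discounts away.\<close>

lemma regvar_dilate_le:
  fixes f :: "real \<Rightarrow> real"
  assumes nn: "\<And>z. 0 < z \<Longrightarrow> 0 \<le> f z" and anti: "\<And>x y. 0 < x \<Longrightarrow> x \<le> y \<Longrightarrow> f y \<le> f x"
    and lim: "((\<lambda>y. f (x * y) / f y) \<longlongrightarrow> L) (at_right 0)"
    and "x > 0" "0 < L" "L < A"
  obtains C where "C \<ge> 0" "\<And>z. z > 0 \<Longrightarrow> f (x * z) \<le> A * f z + C"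
proof -
  have "\<forall>\<^sub>F y in at_right 0. f (x * y) / f y < A"
    by (rule order_tendstoD[OF lim]) fact
  moreover have "\<forall>\<^sub>F y in at_right 0. f y > 0"
    by (rule ratio_limit_pos[OF lim]) (use assms in auto)
  ultimately have "\<forall>\<^sub>F y in at_right 0. f (x * y) \<le> A * f y"
    by eventually_elim (simp add: divide_less_eq)
  then obtain z0 where z0: "z0 > 0" "\<And>z. 0 < z \<Longrightarrow> z \<le> z0 \<Longrightarrow> f (x * z) \<le> A * f z"
    by (rule eventually_at_right_0_le) auto
  show ?thesis
  proof (rule that[of "f (x * z0)"])
    fix z :: real assume z: "z > 0"
    show "f (x * z) \<le> A * f z + f (x * z0)"
    proof (cases "z \<le> z0")
      case True
      moreover have "0 \<le> f (x * z0)" using z0 assms by (intro nn) auto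
      ultimately show ?thesis using z0(2)[OF z] by linarith
    next
      case False
      hence "f (x * z) \<le> f (x * z0)" using assms z0 by (intro anti) auto
      moreover have "0 \<le> A * f z" using nn[OF z] assms by simp
      ultimately show ?thesis by simp
    qed
  qed (use nn z0 assms in auto)
qed

text \<open>A Potter-type bound. Because \<open>q < p\<close>, the limiting ratio at dilation 1/2
  strictly exceeds \<open>(1 / 2) powr (p - 1)\<close>, so \<open>f z * z powr (1 - p)\<close> does
  not decrease under halving near 0. Monotonicity of \<open>f\<close> controls the points within one
  dyadic shell.\<close>

lemma regvar_lower_bound:
  fixes f :: "real \<Rightarrow> real"
  assumes nn: "\<And>z. 0 < z \<Longrightarrow> 0 \<le> f z" and anti: "\<And>x y. 0 < x \<Longrightarrow> x \<le> y \<Longrightarrow> f y \<le> f x"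
    and lim: "\<And>x. x > 0 \<Longrightarrow> ((\<lambda>y. f (x * y) / f y) \<longlongrightarrow> x powr (q - 1)) (at_right 0)"
    and "q < p" "p \<le> 1"
  obtains c z0 where "c > 0" "z0 > 0" "\<And>z. 0 < z \<Longrightarrow> z \<le> z0 \<Longrightarrow> c * z powr (p - 1) \<le> f z"
proof -
  have "(1 / 2) powr (p - 1) < (1 / 2 :: real) powr (q - 1)"
    using assms by (intro powr_less_mono') auto
  hence "\<forall>\<^sub>F y in at_right 0. f (1 / 2 * y) / f y > (1 / 2) powr (p - 1)"
    by (intro order_tendstoD(1)[OF lim]) auto
  moreover have "\<forall>\<^sub>F y in at_right 0. f y > 0"
    by (rule ratio_limit_pos[OF lim[of 1]]) (use assms in auto)
  ultimately have "\<forall>\<^sub>F y in at_right 0. f y > 0 \<and> (1 / 2) powr (p - 1) * f y \<le> f (y / 2)"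
    by eventually_elim (simp add: less_divide_eq)
  then obtain z0 where z0: "z0 > 0"
    "\<And>z. 0 < z \<Longrightarrow> z \<le> z0 \<Longrightarrow> f z > 0 \<and> (1 / 2) powr (p - 1) * f z \<le> f (z / 2)"
    by (rule eventually_at_right_0_le) auto
  \<comment> \<open>On \<open>[z0 / 2, z0]\<close> the decreasing \<open>f\<close> is smallest at
    the right end and the nondecreasing power at the left end.\<close>
  define c where "c = f z0 * (z0 / 2) powr (1 - p)"
  have c: "c > 0" using z0 by (simp add: c_def)
  show ?thesis
  proof (rule that[of c z0])
    fix z assume z: "0 < z" "z \<le> z0"
    \<comment> \<open>Negated because \<open>dyadic_bound\<close> propagates upper bounds.\<close>
    have "- (f z * z powr (1 - p)) \<le> - c"
    proof (rule dyadic_bound[where g = "\<lambda>z. - (f z * z powr (1 - p))" and M = "-c", OF _ _ z])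
      fix z assume z: "0 < z" "z \<le> z0"
      have "f z * z powr (1 - p) = (1 / 2) powr (p - 1) * f z * (z / 2) powr (1 - p)"
        using z by (simp add: powr_divide powr_minus_divide powr_diff field_simps)
      also have "\<dots> \<le> f (z / 2) * (z / 2) powr (1 - p)"
        using z0(2)[OF z] by (intro mult_right_mono) auto
      finally show "- (f (z / 2) * (z / 2) powr (1 - p)) \<le> - (f z * z powr (1 - p))" by simp
    next
      fix z assume z: "z0 / 2 \<le> z" "z \<le> z0"
      have "(z0 / 2) powr (1 - p) \<le> z powr (1 - p)" using z z0 assms by (intro powr_mono2) auto
      moreover have "f z0 \<le> f z" using z z0 by (intro anti) auto
      ultimately have "c \<le> f z * z powr (1 - p)"
        unfolding c_def using z z0 nn[of z] by (intro mult_mono) auto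
      thus "- (f z * z powr (1 - p)) \<le> - c" by simp
    qed
    hence "c * z powr (p - 1) \<le> f z * z powr (1 - p) * z powr (p - 1)"
      by (intro mult_right_mono) auto
    also have "\<dots> = f z" using z by (simp add: mult.assoc powr_add[symmetric])
    finally show "c * z powr (p - 1) \<le> f z" .
  qed fact+
qed

text \<open>Mirror image of \<open>regvar_lower_bound\<close>: with \<open>p < q\<close> the same
  product does not increase under halving.\<close>

lemma regvar_upper_bound:
  fixes f :: "real \<Rightarrow> real"
  assumes nn: "\<And>z. 0 < z \<Longrightarrow> 0 \<le> f z" and anti: "\<And>x y. 0 < x \<Longrightarrow> x \<le> y \<Longrightarrow> f y \<le> f x"
    and lim: "\<And>x. x > 0 \<Longrightarrow> ((\<lambda>y. f (x * y) / f y) \<longlongrightarrow> x powr (q - 1)) (at_right 0)"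
    and "p < q" "p \<le> 1"
  obtains C z0 where "C \<ge> 0" "z0 > 0" "\<And>z. 0 < z \<Longrightarrow> z \<le> z0 \<Longrightarrow> f z \<le> C * z powr (p - 1)"
proof -
  have "(1 / 2) powr (q - 1) < (1 / 2 :: real) powr (p - 1)"
    using assms by (intro powr_less_mono') auto
  hence "\<forall>\<^sub>F y in at_right 0. f (1 / 2 * y) / f y < (1 / 2) powr (p - 1)"
    by (intro order_tendstoD(2)[OF lim]) auto
  moreover have "\<forall>\<^sub>F y in at_right 0. f y > 0"
    by (rule ratio_limit_pos[OF lim[of 1]]) (use assms in auto)
  ultimately have "\<forall>\<^sub>F y in at_right 0. f (y / 2) \<le> (1 / 2) powr (p - 1) * f y"
    by eventually_elim (simp add: divide_less_eq)
  then obtain z0 where z0: "z0 > 0"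
    "\<And>z. 0 < z \<Longrightarrow> z \<le> z0 \<Longrightarrow> f (z / 2) \<le> (1 / 2) powr (p - 1) * f z"
    by (rule eventually_at_right_0_le) auto
  define C where "C = f (z0 / 2) * z0 powr (1 - p)"
  have C: "C \<ge> 0" using z0 nn by (simp add: C_def)
  show ?thesis
  proof (rule that[of C z0])
    fix z assume z: "0 < z" "z \<le> z0"
    have "f z * z powr (1 - p) \<le> C"
    proof (rule dyadic_bound[where g = "\<lambda>z. f z * z powr (1 - p)" and M = C, OF _ _ z])
      fix z assume z: "0 < z" "z \<le> z0"
      have "f (z / 2) * (z / 2) powr (1 - p) \<le> (1 / 2) powr (p - 1) * f z * (z / 2) powr (1 - p)"
        using z0(2)[OF z] by (intro mult_right_mono) auto
      also have "\<dots> = f z * z powr (1 - p)"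
        using z by (simp add: powr_divide powr_minus_divide powr_diff field_simps)
      finally show "f (z / 2) * (z / 2) powr (1 - p) \<le> f z * z powr (1 - p)" .
    next
      fix z assume z: "z0 / 2 \<le> z" "z \<le> z0"
      have "z powr (1 - p) \<le> z0 powr (1 - p)" using z z0 assms by (intro powr_mono2) auto
      moreover have "f z \<le> f (z0 / 2)" using z z0 by (intro anti) auto
      ultimately show "f z * z powr (1 - p) \<le> C"
        unfolding C_def using z z0 nn[of "z0 / 2"] by (intro mult_mono) auto
    qed
    hence "f z * z powr (1 - p) * z powr (p - 1) \<le> C * z powr (p - 1)"
      by (intro mult_right_mono) auto
    moreover have "f z * z powr (1 - p) * z powr (p - 1) = f z"
      using z by (simp add: mult.assoc powr_add[symmetric])
    ultimately show "f z \<le> C * z powr (p - 1)" by simp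
  qed fact+
qed

text \<open>Here \<open>h\<close> is minus \<open>z\<close> times the derivative of
  \<open>f\<close>. The sign of the result compares the elasticity \<open>h / f\<close> with
  \<open>1 - p\<close>, which makes power bounds for \<open>f\<close> a monotonicity
  question.\<close>

lemma elasticity_deriv:
  assumes "(f has_real_derivative - (h z / z)) (at z)" "z > 0"
  shows "((\<lambda>z. f z * z powr (1 - p)) has_real_derivative ((1 - p) * f z - h z) * z powr (- p)) (at z)"
proof -
  have "((\<lambda>z. f z * z powr (1 - p)) has_real_derivative
      f z * ((1 - p) * z powr (1 - p - 1)) + - (h z / z) * z powr (1 - p)) (at z)"
    using assms has_real_derivative_powr[of z "1 - p"]
    by (intro DERIV_cong[OF DERIV_mult]) auto
  moreover have "f z * ((1 - p) * z powr (1 - p - 1)) + - (h z / z) * z powr (1 - p) =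
      ((1 - p) * f z - h z) * z powr (- p)"
    using assms by (simp add: powr_diff powr_minus field_simps)
  ultimately show ?thesis by simp
qed

text \<open>Differential counterpart of \<open>regvar_lower_bound\<close>: where
  \<open>h / f\<close> exceeds \<open>1 - p\<close>, the function
  \<open>f z * z powr (1 - p)\<close> is nonincreasing, so its value at \<open>z0\<close> bounds it
  from below.\<close>

lemma elasticity_lower_bound:
  fixes f h :: "real \<Rightarrow> real"
  assumes nn: "\<And>z. 0 < z \<Longrightarrow> 0 \<le> f z"
    and der: "\<And>z. 0 < z \<Longrightarrow> (f has_real_derivative - (h z / z)) (at z)"
    and lim: "((\<lambda>y. h y / f y) \<longlongrightarrow> 1 - q) (at_right 0)"
    and "q < p" "q < 1"
  obtains c z0 where "c > 0" "z0 > 0" "\<And>z. 0 < z \<Longrightarrow> z \<le> z0 \<Longrightarrow> c * z powr (p - 1) \<le> f z"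
proof -
  have "\<forall>\<^sub>F y in at_right 0. h y / f y > 1 - p"
    by (intro order_tendstoD(1)[OF lim]) (use assms in auto)
  moreover have "\<forall>\<^sub>F y in at_right 0. f y > 0"
    by (rule ratio_limit_pos[OF lim]) (use assms in auto)
  ultimately have "\<forall>\<^sub>F y in at_right 0. f y > 0 \<and> (1 - p) * f y \<le> h y"
    by eventually_elim (simp add: less_divide_eq)
  then obtain z0 where z0: "z0 > 0" "\<And>z. 0 < z \<Longrightarrow> z \<le> z0 \<Longrightarrow> f z > 0 \<and> (1 - p) * f z \<le> h z"
    by (rule eventually_at_right_0_le) auto
  define c where "c = f z0 * z0 powr (1 - p)"
  show ?thesis
  proof (rule that[of c z0])
    fix z assume z: "0 < z" "z \<le> z0"
    have "c \<le> f z * z powr (1 - p)"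
      unfolding c_def
    proof (rule DERIV_nonpos_imp_nonincreasing[OF z(2)])
      fix w assume "z \<le> w" "w \<le> z0"
      thus "\<exists>y. ((\<lambda>z. f z * z powr (1 - p)) has_real_derivative y) (at w) \<and> y \<le> 0"
        using elasticity_deriv[where f = f and h = h and z = w and p = p, OF der] z z0(2)[of w]
        by (intro exI[of _ "((1 - p) * f w - h w) * w powr (- p)"]) (auto intro!: mult_nonpos_nonneg)
    qed
    hence "c * z powr (p - 1) \<le> f z * z powr (1 - p) * z powr (p - 1)"
      by (intro mult_right_mono) auto
    also have "\<dots> = f z" using z by (simp add: mult.assoc powr_add[symmetric])
    finally show "c * z powr (p - 1) \<le> f z" .
  qed (use z0 c_def in auto)
qed

lemma elasticity_upper_bound:
  fixes f h :: "real \<Rightarrow> real"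
  assumes nn: "\<And>z. 0 < z \<Longrightarrow> 0 \<le> f z"
    and der: "\<And>z. 0 < z \<Longrightarrow> (f has_real_derivative - (h z / z)) (at z)"
    and lim: "((\<lambda>y. h y / f y) \<longlongrightarrow> 1 - q) (at_right 0)"
    and "p < q" "q < 1"
  obtains C z0 where "C \<ge> 0" "z0 > 0" "\<And>z. 0 < z \<Longrightarrow> z \<le> z0 \<Longrightarrow> f z \<le> C * z powr (p - 1)"
proof -
  have "\<forall>\<^sub>F y in at_right 0. h y / f y < 1 - p"
    by (intro order_tendstoD(2)[OF lim]) (use assms in auto)
  moreover have "\<forall>\<^sub>F y in at_right 0. f y > 0"
    by (rule ratio_limit_pos[OF lim]) (use assms in auto)
  ultimately have "\<forall>\<^sub>F y in at_right 0. (1 - p) * f y \<ge> h y"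
    by eventually_elim (simp add: divide_less_eq)
  then obtain z0 where z0: "z0 > 0" "\<And>z. 0 < z \<Longrightarrow> z \<le> z0 \<Longrightarrow> (1 - p) * f z \<ge> h z"
    by (rule eventually_at_right_0_le) auto
  define C where "C = f z0 * z0 powr (1 - p)"
  show ?thesis
  proof (rule that[of C z0])
    fix z assume z: "0 < z" "z \<le> z0"
    have "f z * z powr (1 - p) \<le> C"
      unfolding C_def
    proof (rule DERIV_nonneg_imp_nondecreasing[OF z(2)])
      fix w assume "z \<le> w" "w \<le> z0"
      thus "\<exists>y. ((\<lambda>z. f z * z powr (1 - p)) has_real_derivative y) (at w) \<and> y \<ge> 0"
        using elasticity_deriv[where f = f and h = h and z = w and p = p, OF der] z z0(2)[of w]
        by (intro exI[of _ "((1 - p) * f w - h w) * w powr (- p)"]) auto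
    qed
    hence "f z * z powr (1 - p) * z powr (p - 1) \<le> C * z powr (p - 1)"
      by (intro mult_right_mono) auto
    moreover have "f z * z powr (1 - p) * z powr (p - 1) = f z"
      using z by (simp add: mult.assoc powr_add[symmetric])
    ultimately show "f z \<le> C * z powr (p - 1)" by simp
  qed (use z0 nn C_def in auto)
qed

text \<open>The additive constant extends the bound near 0 to all \<open>z > 0\<close>, the form to
  which the monotone averaging can be applied.\<close>

lemma global_lower_bound:
  fixes f :: "real \<Rightarrow> real"
  assumes nn: "\<And>z. 0 < z \<Longrightarrow> 0 \<le> f z"
    and b: "c > 0" "z0 > 0" "\<And>z. 0 < z \<Longrightarrow> z \<le> z0 \<Longrightarrow> c * z powr (p - 1) \<le> f z"
    and "p \<le> 1" "0 < z"
  shows "c * z powr (p - 1) \<le> f z + c * z0 powr (p - 1)"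
proof (cases "z \<le> z0")
  case True
  thus ?thesis using b(3)[of z] b assms by (smt (verit) mult_nonneg_nonneg powr_ge_zero)
next
  case False
  hence "z powr (p - 1) \<le> z0 powr (p - 1)" using assms by (intro powr_mono2') auto
  hence "c * z powr (p - 1) \<le> c * z0 powr (p - 1)" using b by (intro mult_left_mono) auto
  thus ?thesis using nn[OF \<open>0 < z\<close>] by linarith
qed

lemma global_upper_bound:
  fixes f :: "real \<Rightarrow> real"
  assumes anti: "\<And>x y. 0 < x \<Longrightarrow> x \<le> y \<Longrightarrow> f y \<le> f x"
    and b: "C \<ge> 0" "z0 > 0" "\<And>z. 0 < z \<Longrightarrow> z \<le> z0 \<Longrightarrow> f z \<le> C * z powr (p - 1)"
    and tail: "D \<ge> 0" "\<And>z. z \<ge> 1 \<Longrightarrow> f z \<le> D * z powr (s - 1)"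
    and "p \<le> 1" "s \<le> 1"
  obtains E where "E \<ge> 0" "\<And>z. z > 0 \<Longrightarrow> f z \<le> E * (z powr (p - 1) + z powr (s - 1))"
proof (rule that[of "C + D + \<bar>f z0\<bar>"])
  fix z :: real assume z: "z > 0"
  let ?p = "z powr (p - 1)" and ?s = "z powr (s - 1)"
  consider "z \<le> z0" | "z \<ge> 1" | "z > z0" "z < 1" by linarith
  thus "f z \<le> (C + D + \<bar>f z0\<bar>) * (?p + ?s)"
  proof cases
    case 1
    have "C * ?p \<le> (C + D + \<bar>f z0\<bar>) * (?p + ?s)" using b tail by (intro mult_mono) auto
    thus ?thesis using b(3)[OF z 1] by linarith
  next
    case 2
    have "D * ?s \<le> (C + D + \<bar>f z0\<bar>) * (?p + ?s)" using b tail by (intro mult_mono) auto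
    thus ?thesis using tail(2)[OF 2] by linarith
  next
    \<comment> \<open>In the gap between \<open>z0\<close> and 1 neither bound is available; there
      \<open>f\<close> is at most \<open>f z0\<close> and the first power is at least 1.\<close>
    case 3
    have "1 \<le> ?p" using 3 z assms powr_mono2'[of "p - 1" z 1] by auto
    hence "\<bar>f z0\<bar> * 1 \<le> (C + D + \<bar>f z0\<bar>) * (?p + ?s)"
      using b tail by (intro mult_mono) (auto intro: add_increasing2)
    thus ?thesis using anti[of z0 z] 3 b by linarith
  qed
qed (use b tail in auto)

text \<open>The equation \<open>f' = - (h / z)\<close> is integrated from \<open>z\<close> to
  infinity: \<open>f\<close> minus the claimed bound is nondecreasing on
  \<open>[z, \<infinity>)\<close> and tends to 0.\<close>

lemma tail_bound:
  fixes f h :: "real \<Rightarrow> real"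
  assumes der: "\<And>z. z \<ge> 1 \<Longrightarrow> (f has_real_derivative - (h z / z)) (at z)"
    and b: "\<And>z. z \<ge> 1 \<Longrightarrow> h z \<le> K * z powr (s - 1)" and "s < 1"
    and lim: "(f \<longlongrightarrow> 0) at_top" and "z \<ge> 1"
  shows "f z \<le> K / (1 - s) * z powr (s - 1)"
proof -
  define g where "g w = f w - K / (1 - s) * w powr (s - 1)" for w
  have mono: "g z \<le> g w" if "z \<le> w" for w
  proof (rule DERIV_nonneg_imp_nondecreasing[OF that])
    fix u assume u: "z \<le> u" "u \<le> w"
    have "(g has_real_derivative - (h u / u) - K / (1 - s) * ((s - 1) * u powr (s - 1 - 1))) (at u)"
      unfolding g_def using u assms
      by (intro DERIV_diff DERIV_cmult has_real_derivative_powr der) auto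
    moreover have "- (h u / u) - K / (1 - s) * ((s - 1) * u powr (s - 1 - 1)) = (K * u powr (s - 1) - h u) / u"
    proof -
      have "u powr (s - 1 - 1) = u powr (s - 1) / u" using powr_diff[of u "s - 1" 1] u assms by simp
      moreover have "K / (1 - s) * (s - 1) = - K" using assms by (simp add: field_simps)
      ultimately show ?thesis by (simp add: mult.assoc[symmetric] diff_divide_distrib)
    qed
    ultimately show "\<exists>y. (g has_real_derivative y) (at u) \<and> 0 \<le> y"
      using b[of u] u assms by (intro exI[of _ "(K * u powr (s - 1) - h u) / u"]) auto
  qed
  have "((\<lambda>w. w powr (s - 1)) \<longlongrightarrow> 0) at_top"
    by (rule tendsto_neg_powr) (use assms in \<open>auto intro: filterlim_ident\<close>)
  hence "(g \<longlongrightarrow> 0 - K / (1 - s) * 0) at_top"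
    unfolding g_def by (intro tendsto_diff tendsto_mult lim tendsto_const)
  hence "g z \<le> 0"
    by (intro tendsto_lowerbound[of g 0 at_top]) (auto simp: eventually_at_top_linorder intro: mono)
  thus ?thesis by (simp add: g_def)
qed
section \<open>Dual functions\<close>

lemma utility_bdd_above:
  assumes "utility U" "y > 0"
  shows "bdd_above ((\<lambda>x. U x - x * y) ` {0..})"
proof -
  obtain C p where C: "C > 0" "0 < p" "p < 1" and U: "\<And>x. x \<ge> 0 \<Longrightarrow> U x \<le> C * (1 + x powr p)"
    using assms(1) unfolding utility_def by blast
  \<comment> \<open>\<open>X\<close> solves \<open>C * X powr p = X * y\<close>; to its right the
    linear cost exceeds the power.\<close>
  define X where "X = (C / y) powr (1 / (1 - p))"
  have X: "X > 0" using C assms by (simp add: X_def)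
  have Xp: "X powr (1 - p) = C / y" using C assms by (simp add: X_def powr_powr)
  show ?thesis
  proof (rule bdd_aboveI2)
    fix x :: real assume "x \<in> {0..}"
    hence x: "x \<ge> 0" by simp
    have "C * x powr p \<le> C * X powr p + x * y"
    proof (cases "x \<le> X")
      case True
      hence "C * x powr p \<le> C * X powr p" using C x by (intro mult_left_mono powr_mono2) auto
      moreover have "0 \<le> x * y" using x assms by simp
      ultimately show ?thesis by linarith
    next
      case False
      hence "X powr (1 - p) \<le> x powr (1 - p)" using C X by (intro powr_mono2) auto
      hence "C \<le> x powr (1 - p) * y" using assms Xp by (simp add: field_simps)
      hence "C * x powr p \<le> x powr (1 - p) * y * x powr p" by (intro mult_right_mono) auto
      also have "\<dots> = x * y" using False X by (simp add: powr_add[symmetric] mult_ac)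
      moreover have "0 \<le> C * X powr p" using C by simp
      ultimately show ?thesis by linarith
    qed
    thus "U x - x * y \<le> C + C * X powr p" using U[OF x] by (simp add: distrib_left)
  qed
qed

lemma dual_fun_ge:
  assumes "utility U" "y > 0" "x \<ge> 0"
  shows "U x - x * y \<le> dual_fun U y"
  unfolding dual_fun_def by (rule cSUP_upper[OF _ utility_bdd_above]) (use assms in auto)

lemma dual_fun_nonneg:
  assumes "utility U" "y > 0"
  shows "0 \<le> dual_fun U y"
  using dual_fun_ge[OF assms, of 0] assms by (simp add: utility_def)

lemma dual_fun_antimono:
  assumes "utility U" "0 < y" "y \<le> y'"
  shows "dual_fun U y' \<le> dual_fun U y"
proof (subst dual_fun_def, rule cSUP_least)
  fix x :: real assume "x \<in> {0..}"
  hence "U x - x * y' \<le> U x - x * y" using assms by (auto intro: mult_left_mono)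
  also have "\<dots> \<le> dual_fun U y" using assms \<open>x \<in> {0..}\<close> by (intro dual_fun_ge) auto
  finally show "U x - x * y' \<le> dual_fun U y" .
qed auto

text \<open>A supremum of functions affine in \<open>y\<close> is convex; this also yields the
  tangent inequality and the monotonicity of the derivative.\<close>

lemma dual_fun_convex:
  assumes "utility U" shows "convex_on {0<..} (dual_fun U)"
proof (rule convex_onI)
  fix t y y' :: real assume t: "0 < t" "t < 1" and y: "y \<in> {0<..}" "y' \<in> {0<..}"
  show "dual_fun U ((1 - t) *\<^sub>R y + t *\<^sub>R y') \<le> (1 - t) * dual_fun U y + t * dual_fun U y'"
  proof (subst dual_fun_def, rule cSUP_least)
    fix x :: real assume x: "x \<in> {0..}"
    have "U x - x * ((1 - t) *\<^sub>R y + t *\<^sub>R y') = (1 - t) * (U x - x * y) + t * (U x - x * y')"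
      by (simp add: algebra_simps)
    also have "\<dots> \<le> (1 - t) * dual_fun U y + t * dual_fun U y'"
      using t x y by (intro add_mono mult_left_mono dual_fun_ge assms) auto
    finally show "U x - x * ((1 - t) *\<^sub>R y + t *\<^sub>R y') \<le> (1 - t) * dual_fun U y + t * dual_fun U y'" .
  qed auto
qed auto

lemma dual_fun_tangent:
  assumes "utility U" "(dual_fun U has_real_derivative D) (at y)" "y > 0" "y' > 0"
  shows "dual_fun U y + D * (y' - y) \<le> dual_fun U y'"
proof -
  have "D * (y' - y) \<le> dual_fun U y' - dual_fun U y"
    by (rule convex_on_imp_above_tangent[OF dual_fun_convex[OF assms(1)]])
      (use assms in \<open>auto simp: interior_open intro: has_field_derivative_at_within\<close>)
  thus ?thesis by linarith
qed

lemma dual_fun_deriv_mono: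
  assumes "utility U" "(dual_fun U has_real_derivative D) (at y)"
    and "(dual_fun U has_real_derivative D') (at y')" "0 < y" "y \<le> y'"
  shows "D \<le> D'"
proof (cases "y = y'")
  case True thus ?thesis using assms DERIV_unique by blast
next
  case False
  have "dual_fun U y + D * (y' - y) \<le> dual_fun U y'" "dual_fun U y' + D' * (y - y') \<le> dual_fun U y"
    using assms by (auto intro!: dual_fun_tangent)
  hence "D * (y' - y) \<le> D' * (y' - y)" by (simp add: algebra_simps)
  thus ?thesis using False assms by (simp add: mult_le_cancel_right)
qed

lemma dual_fun_deriv_nonpos:
  assumes "utility U" "(dual_fun U has_real_derivative D) (at y)" "0 < y"
  shows "D \<le> 0"
  using dual_fun_tangent[OF assms, of "y + 1"] dual_fun_antimono[OF assms(1,3), of "y + 1"] assms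
  by simp

text \<open>A slope staying below \<open>- e\<close> would drive the nonnegative dual function below
  0; monotonicity of the slope then gives the limit.\<close>

lemma dual_fun_deriv_tendsto_0:
  assumes U: "utility U" and D: "\<And>y. y > 0 \<Longrightarrow> (dual_fun U has_real_derivative D y) (at y)"
  shows "(D \<longlongrightarrow> 0) at_top"
proof (rule tendstoI)
  fix e :: real assume e: "e > 0"
  have "\<exists>y>0. - e < D y"
  proof (rule ccontr)
    assume "\<not> ?thesis"
    hence *: "D y \<le> - e" if "y > 0" for y using that by force
    \<comment> \<open>Chosen so that a descent at rate \<open>e\<close> from 1 to \<open>Y\<close>
      loses \<open>dual_fun U 1 + 1\<close>, more than is available.\<close>
    define Y where "Y = 1 + (dual_fun U 1 + 1) / e"
    have Y: "Y \<ge> 1" using dual_fun_nonneg[OF U, of 1] e by (simp add: Y_def)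
    have "dual_fun U Y + D Y * (1 - Y) \<le> dual_fun U 1"
      by (rule dual_fun_tangent[OF U D]) (use Y in auto)
    moreover have "e * (Y - 1) \<le> D Y * (1 - Y)"
      using mult_right_mono[of "D Y" "-e" "Y - 1"] * Y by (simp add: algebra_simps)
    moreover have "e * (Y - 1) = dual_fun U 1 + 1" using e by (simp add: Y_def)
    ultimately show False using dual_fun_nonneg[OF U, of Y] Y by linarith
  qed
  then obtain y where y: "y > 0" "- e < D y" by blast
  have "dist (D z) 0 < e" if "z \<ge> y" for z
    using dual_fun_deriv_mono[OF U D D, of y z] dual_fun_deriv_nonpos[OF U D, of z] y that by auto
  thus "\<forall>\<^sub>F z in at_top. dist (D z) 0 < e" by (auto simp: eventually_at_top_linorder)
qed

section \<open>The Gaussian averaging operator\<close>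

text \<open>One power is meant for the behaviour at 0, the other for infinity, in either order.
  Exponents at most 1 make both powers nonincreasing in \<open>z\<close>, so a majorant at
  \<open>y / 2\<close> serves for all larger arguments.\<close>

definition power_bounded :: "(real \<Rightarrow> real) \<Rightarrow> bool" where
  "power_bounded f \<longleftrightarrow> continuous_on {0<..} f \<and>
     (\<exists>C p q. p \<le> 1 \<and> q \<le> 1 \<and> C \<ge> 0 \<and>
        (\<forall>z>0. \<bar>f z\<bar> \<le> C * (z powr (p - 1) + z powr (q - 1))))"

lemma power_boundedI:
  assumes "continuous_on {0<..} f" "p \<le> 1" "q \<le> 1" "C \<ge> 0"
    and "\<And>z. z > 0 \<Longrightarrow> \<bar>f z\<bar> \<le> C * (z powr (p - 1) + z powr (q - 1))"
  shows "power_bounded f"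
  using assms unfolding power_bounded_def by blast

lemma power_bounded_powr: "q \<le> 1 \<Longrightarrow> power_bounded (\<lambda>z. z powr (q - 1))"
  by (rule power_boundedI[of _ q q 1]) (auto intro!: continuous_intros)

lemma power_bounded_const: "power_bounded (\<lambda>z. c)"
  by (rule power_boundedI[of _ 1 1 "\<bar>c\<bar>"]) auto

lemma power_bounded_cmult: "power_bounded f \<Longrightarrow> power_bounded (\<lambda>z. c * f z)"
proof -
  assume "power_bounded f"
  then obtain C p q where c: "continuous_on {0<..} f" and C: "p \<le> 1" "q \<le> 1" "C \<ge> 0"
    and b: "\<And>z. z > 0 \<Longrightarrow> \<bar>f z\<bar> \<le> C * (z powr (p - 1) + z powr (q - 1))"
    unfolding power_bounded_def by blast
  show ?thesis
  proof (rule power_boundedI[of _ p q "\<bar>c\<bar> * C"])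
    fix z :: real assume "z > 0"
    from mult_left_mono[OF b[OF this], of "\<bar>c\<bar>"]
    show "\<bar>c * f z\<bar> \<le> \<bar>c\<bar> * C * (z powr (p - 1) + z powr (q - 1))"
      by (simp add: abs_mult mult.assoc)
  qed (use c C in \<open>auto intro!: continuous_intros\<close>)
qed

lemma powr_le_sum_powr:
  fixes z p q s :: real
  assumes "z > 0" "p \<le> s" "s \<le> q"
  shows "z powr s \<le> z powr p + z powr q"
proof (cases "z \<le> 1")
  case True
  hence "z powr s \<le> z powr p" using assms by (intro powr_mono') auto
  thus ?thesis by (smt (verit) powr_ge_zero)
next
  case False
  hence "z powr s \<le> z powr q" using assms by (intro powr_mono) auto
  thus ?thesis by (smt (verit) powr_ge_zero)
qed

lemma power_bounded_add:
  assumes "power_bounded f" "power_bounded g"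
  shows "power_bounded (\<lambda>z. f z + g z)"
proof -
  obtain C p q where c: "continuous_on {0<..} f" and C: "p \<le> 1" "q \<le> 1" "C \<ge> 0"
    and b: "\<And>z. z > 0 \<Longrightarrow> \<bar>f z\<bar> \<le> C * (z powr (p - 1) + z powr (q - 1))"
    using assms(1) unfolding power_bounded_def by blast
  obtain C' p' q' where c': "continuous_on {0<..} g" and C': "p' \<le> 1" "q' \<le> 1" "C' \<ge> 0"
    and b': "\<And>z. z > 0 \<Longrightarrow> \<bar>g z\<bar> \<le> C' * (z powr (p' - 1) + z powr (q' - 1))"
    using assms(2) unfolding power_bounded_def by blast
  \<comment> \<open>Each of the four powers lies between the two with extreme exponents and is hence
    at most their sum.\<close>
  define P where "P = min (min p q) (min p' q')"
  define Q where "Q = max (max p q) (max p' q')"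
  show ?thesis
  proof (rule power_boundedI[of _ P Q "2 * C + 2 * C'"])
    fix z :: real assume z: "z > 0"
    have *: "z powr (s - 1) \<le> z powr (P - 1) + z powr (Q - 1)" if "s \<in> {p, q, p', q'}" for s
      by (rule powr_le_sum_powr) (use z that in \<open>auto simp: P_def Q_def\<close>)
    have "\<bar>f z + g z\<bar> \<le> C * (z powr (p - 1) + z powr (q - 1)) + C' * (z powr (p' - 1) + z powr (q' - 1))"
      using b[OF z] b'[OF z] by linarith
    also have "\<dots> \<le> C * (2 * (z powr (P - 1) + z powr (Q - 1))) + C' * (2 * (z powr (P - 1) + z powr (Q - 1)))"
      using *[of p] *[of q] *[of p'] *[of q'] C C' by (intro add_mono mult_left_mono) auto
    finally show "\<bar>f z + g z\<bar> \<le> (2 * C + 2 * C') * (z powr (P - 1) + z powr (Q - 1))"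
      by (simp add: algebra_simps)
  qed (use c c' C C' in \<open>auto simp: P_def Q_def intro!: continuous_intros\<close>)
qed

lemma power_bounded_dilate:
  assumes "power_bounded f" "c > 0"
  shows "power_bounded (\<lambda>z. f (c * z))"
proof -
  obtain C p q where c: "continuous_on {0<..} f" and C: "p \<le> 1" "q \<le> 1" "C \<ge> 0"
    and b: "\<And>z. z > 0 \<Longrightarrow> \<bar>f z\<bar> \<le> C * (z powr (p - 1) + z powr (q - 1))"
    using assms(1) unfolding power_bounded_def by blast
  define D where "D = c powr (p - 1) + c powr (q - 1)"
  show ?thesis
  proof (rule power_boundedI[of _ p q "C * D"])
    fix z :: real assume z: "z > 0"
    have "\<bar>f (c * z)\<bar> \<le> C * (c powr (p - 1) * z powr (p - 1) + c powr (q - 1) * z powr (q - 1))"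
      using b[of "c * z"] z assms by (simp add: powr_mult)
    also have "\<dots> \<le> C * (D * z powr (p - 1) + D * z powr (q - 1))"
      using C by (intro mult_left_mono add_mono mult_right_mono) (auto simp: D_def)
    finally show "\<bar>f (c * z)\<bar> \<le> C * D * (z powr (p - 1) + z powr (q - 1))"
      by (simp add: algebra_simps)
  next
    show "continuous_on {0<..} (\<lambda>z. f (c * z))"
      by (rule continuous_on_compose2[OF c]) (use assms in \<open>auto intro!: continuous_intros\<close>)
  qed (use C D_def in auto)
qed

text \<open>The nonpositive exponents make the bound at \<open>y / 2 * w\<close> uniform over
  \<open>z > y / 2\<close>, as needed to differentiate at \<open>y\<close> under the
  integral.\<close>

lemma power_bounded_interval_bound:
  assumes "power_bounded h" "y > 0"
  obtains C p q where "p \<le> 1" "q \<le> 1" "C \<ge> 0"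
    "\<And>z w. \<lbrakk>y / 2 < z; w > 0\<rbrakk> \<Longrightarrow> \<bar>h (z * w)\<bar> \<le> C * ((y / 2 * w) powr (p - 1) + (y / 2 * w) powr (q - 1))"
    "\<And>z. z > 0 \<Longrightarrow> \<bar>h z\<bar> \<le> C * (z powr (p - 1) + z powr (q - 1))"
proof -
  obtain C p q where C: "p \<le> 1" "q \<le> 1" "C \<ge> 0"
    and b: "\<And>z. z > 0 \<Longrightarrow> \<bar>h z\<bar> \<le> C * (z powr (p - 1) + z powr (q - 1))"
    using assms(1) unfolding power_bounded_def by blast
  show ?thesis
  proof (rule that[OF C _ b])
    fix z w :: real assume z: "y / 2 < z" "w > 0"
    have le: "y / 2 * w \<le> z * w" "0 < y / 2 * w" "0 < z * w" using z assms by auto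
    have "\<bar>h (z * w)\<bar> \<le> C * ((z * w) powr (p - 1) + (z * w) powr (q - 1))" by (rule b) fact
    also have "\<dots> \<le> C * ((y / 2 * w) powr (p - 1) + (y / 2 * w) powr (q - 1))"
      using C le by (intro mult_left_mono add_mono powr_mono2') auto
    finally show "\<bar>h (z * w)\<bar> \<le> C * ((y / 2 * w) powr (p - 1) + (y / 2 * w) powr (q - 1))" .
  qed
qed

locale merton =
  fixes r \<delta> \<theta> :: real
  assumes r_pos: "r > 0" and \<delta>_pos: "\<delta> > 0" and \<theta>_nz: "\<theta> \<noteq> 0"
begin

abbreviation \<alpha> where "\<alpha> \<equiv> alpha_const r \<delta> \<theta>"
abbreviation a where "a \<equiv> a_const \<theta>"
abbreviation \<beta> where "\<beta> \<equiv> beta_const r \<delta> \<theta>"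

section \<open>The growth exponent of powers\<close>

lemma a_nz: "a \<noteq> 0" using \<theta>_nz by (simp add: a_const_def)

lemma a_sq: "a\<^sup>2 = \<theta>\<^sup>2 / 2" by (simp add: a_const_def power_divide)

text \<open>This is \<open>\<beta> + a\<^sup>2 * (q - \<alpha>)\<^sup>2\<close>, the exponential
  rate at which averaging scales \<open>z powr (q - 1)\<close>. Its smaller root is
  \<open>q_star\<close>.\<close>

definition growth :: "real \<Rightarrow> real" where
  "growth q = a\<^sup>2 * (q\<^sup>2 - 2 * \<alpha> * q) - \<delta>"

lemma growth_1: "growth 1 = - r"
  using \<theta>_nz by (simp add: growth_def a_sq alpha_const_def field_simps)

text \<open>A convex quadratic lies below its chord, and its values at 0 and 1 are
  \<open>- \<delta>\<close> and \<open>- r\<close>.\<close>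

lemma growth_neg:
  assumes "0 \<le> q" "q \<le> 1" shows "growth q < 0"
proof -
  have "growth q = - (1 - q) * \<delta> - q * r - a\<^sup>2 * (q * (1 - q))"
  proof -
    have "growth q = (1 - q) * growth 0 + q * growth 1 - a\<^sup>2 * (q * (1 - q))"
      by (simp add: growth_def power2_eq_square algebra_simps)
    moreover have "growth 0 = - \<delta>" by (simp add: growth_def)
    ultimately show ?thesis by (simp add: growth_1 left_diff_distrib)
  qed
  moreover have "a\<^sup>2 * (q * (1 - q)) \<ge> 0" using assms by simp
  moreover have "(1 - q) * \<delta> + q * r > 0"
    using assms r_pos \<delta>_pos by (cases "q = 0") (auto intro!: add_nonneg_pos)
  ultimately show ?thesis by (simp add: algebra_simps)
qed

lemma q_star_neg: "q_star r \<delta> \<theta> < 0"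
proof -
  have "\<bar>\<alpha>\<bar> < sqrt (\<alpha>\<^sup>2 + 2 * \<delta> / \<theta>\<^sup>2)"
    using \<theta>_nz \<delta>_pos by (intro real_less_rsqrt) auto
  thus ?thesis by (simp add: q_star_def)
qed

lemma growth_pos:
  assumes "q < q_star r \<delta> \<theta>" shows "growth q > 0"
proof -
  have "sqrt (\<alpha>\<^sup>2 + 2 * \<delta> / \<theta>\<^sup>2) < \<alpha> - q" using assms by (simp add: q_star_def)
  moreover have "0 \<le> sqrt (\<alpha>\<^sup>2 + 2 * \<delta> / \<theta>\<^sup>2)" using \<delta>_pos by simp
  ultimately have "(sqrt (\<alpha>\<^sup>2 + 2 * \<delta> / \<theta>\<^sup>2))\<^sup>2 < (\<alpha> - q)\<^sup>2" by (intro power_strict_mono) auto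
  hence "2 * \<delta> / \<theta>\<^sup>2 < (\<alpha> - q)\<^sup>2 - \<alpha>\<^sup>2" using \<delta>_pos by simp
  hence "2 * \<delta> / \<theta>\<^sup>2 * a\<^sup>2 < ((\<alpha> - q)\<^sup>2 - \<alpha>\<^sup>2) * a\<^sup>2" using a_nz by (intro mult_strict_right_mono) auto
  moreover have "2 * \<delta> / \<theta>\<^sup>2 * a\<^sup>2 = \<delta>" using \<theta>_nz by (simp add: a_sq)
  ultimately show ?thesis by (simp add: growth_def power2_eq_square algebra_simps)
qed

text \<open>In the variable \<open>m = 1 - s\<close> the quotient is
  \<open>a\<^sup>2 * m + b - r / m\<close>, increasing for \<open>m > 0\<close>. It is the
  exponential rate of \<open>y\<close> at which \<open>y powr (s - 1) * exp (growth s * t)\<close>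
  stays constant.\<close>

lemma growth_ratio_less:
  assumes "p < q" "q < 1" shows "growth q / (1 - q) < growth p / (1 - p)"
proof -
  define b where "b = a\<^sup>2 * (2 * \<alpha> - 2)"
  have eq: "growth s / (1 - s) = a\<^sup>2 * (1 - s) + b - r / (1 - s)" if "s < 1" for s
  proof -
    have "growth s = a\<^sup>2 * (1 - s)\<^sup>2 + b * (1 - s) - r"
      using growth_1 unfolding growth_def b_def by (simp add: power2_eq_square algebra_simps)
    thus ?thesis using that by (simp add: field_simps power2_eq_square)
  qed
  have "a\<^sup>2 * (1 - q) < a\<^sup>2 * (1 - p)" using assms a_nz by (intro mult_strict_left_mono) auto
  moreover have "r / (1 - p) < r / (1 - q)" using assms r_pos by (intro divide_strict_left_mono) auto
  ultimately show ?thesis using eq[of p] eq[of q] assms by simp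
qed

section \<open>The averaging kernel, its eigenfunctions and its time integral\<close>

definition kern :: "real \<Rightarrow> real \<Rightarrow> real" where
  "kern t \<eta> = exp (\<beta> * t) / (2 * sqrt pi) * exp (- (\<eta>\<^sup>2 / 4) - (\<alpha> - 1) * a * sqrt t * \<eta>)"

definition shock :: "real \<Rightarrow> real \<Rightarrow> real" where
  "shock t \<eta> = exp (a * sqrt t * \<eta>)"

definition smooth :: "(real \<Rightarrow> real) \<Rightarrow> real \<Rightarrow> real \<Rightarrow> real" where
  "smooth f y t = (LBINT \<eta>. kern t \<eta> * f (y * shock t \<eta>))"

definition cumul :: "(real \<Rightarrow> real) \<Rightarrow> real \<Rightarrow> real \<Rightarrow> real" where
  "cumul f y t = (LBINT \<tau>:{0..t}. smooth f y \<tau>)"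

lemma I_fun_eq: "I_fun r \<delta> \<theta> V y t = smooth (\<lambda>z. \<bar>deriv V z\<bar>) y t"
  by (simp add: I_fun_def smooth_def kern_def shock_def mult.assoc)

lemma shock_pos: "shock t \<eta> > 0" by (simp add: shock_def)

lemma kern_pos: "kern t \<eta> > 0" by (simp add: kern_def)

text \<open>Powers are eigenfunctions up to time scaling, because a power of the shock only shifts
  the linear term of the Gaussian exponent. The extra factor \<open>exp (c * \<eta>)\<close>
  prepares for the tilted integrands.\<close>

lemma smooth_powr:
  assumes "y > 0" "t \<ge> 0"
  shows "integrable lborel (\<lambda>\<eta>. kern t \<eta> * exp (c * \<eta>) * (y * shock t \<eta>) powr (q - 1))"
    and "smooth (\<lambda>z. z powr (q - 1)) y t = y powr (q - 1) * exp (growth q * t)"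
proof -
  have eq: "kern t \<eta> * exp (c * \<eta>) * (y * shock t \<eta>) powr (q - 1) =
      exp (\<beta> * t) / (2 * sqrt pi) * y powr (q - 1) * exp (- (\<eta>\<^sup>2 / 4) + ((q - \<alpha>) * a * sqrt t + c) * \<eta>)" for \<eta> c
  proof -
    have "(y * shock t \<eta>) powr (q - 1) = y powr (q - 1) * exp ((q - 1) * (a * sqrt t * \<eta>))"
      using assms by (simp add: powr_mult shock_def powr_def ln_mult exp_add[symmetric] algebra_simps)
    thus ?thesis
      by (simp add: kern_def algebra_simps exp_add[symmetric])
  qed
  show "integrable lborel (\<lambda>\<eta>. kern t \<eta> * exp (c * \<eta>) * (y * shock t \<eta>) powr (q - 1))"
    unfolding eq by (intro integrable_mult_right gaussian_exp_linear)
  have "smooth (\<lambda>z. z powr (q - 1)) y t =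
      (LBINT \<eta>. exp (\<beta> * t) / (2 * sqrt pi) * y powr (q - 1) * exp (- (\<eta>\<^sup>2 / 4) + ((q - \<alpha>) * a * sqrt t + 0) * \<eta>))"
    unfolding smooth_def using eq[where c = 0] by simp
  also have "\<dots> = exp (\<beta> * t) * y powr (q - 1) * exp (((q - \<alpha>) * a * sqrt t + 0)\<^sup>2)"
    by (simp only: integral_mult_right_zero gaussian_exp_linear) simp
  also have "((q - \<alpha>) * a * sqrt t + 0)\<^sup>2 = (q - \<alpha>)\<^sup>2 * a\<^sup>2 * t"
    using assms by (simp add: power_mult_distrib)
  also have "exp (\<beta> * t) * y powr (q - 1) * exp ((q - \<alpha>)\<^sup>2 * a\<^sup>2 * t) = y powr (q - 1) * exp (growth q * t)"
    by (simp add: exp_add[symmetric] growth_def beta_const_def algebra_simps power2_eq_square)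
  finally show "smooth (\<lambda>z. z powr (q - 1)) y t = y powr (q - 1) * exp (growth q * t)" .
qed

lemma kern_integrand_measurable:
  assumes "continuous_on {0<..} f" "y > 0"
  shows "(\<lambda>\<eta>. kern t \<eta> * exp (c * \<eta>) * f (y * shock t \<eta>)) \<in> borel_measurable borel"
  unfolding kern_def shock_def
  by (intro borel_measurable_continuous_onI continuous_intros continuous_on_compose2[OF assms(1)])
    (use assms in auto)

lemma integrable_kern_exp:
  assumes "power_bounded f" "y > 0" "t \<ge> 0"
  shows "integrable lborel (\<lambda>\<eta>. kern t \<eta> * exp (c * \<eta>) * f (y * shock t \<eta>))"
proof -
  obtain C p q where c: "continuous_on {0<..} f" and C: "p \<le> 1" "q \<le> 1" "C \<ge> 0"
    and b: "\<And>z. z > 0 \<Longrightarrow> \<bar>f z\<bar> \<le> C * (z powr (p - 1) + z powr (q - 1))"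
    using assms(1) unfolding power_bounded_def by blast
  let ?g = "\<lambda>\<eta>. C * (kern t \<eta> * exp (c * \<eta>) * (y * shock t \<eta>) powr (p - 1) +
                kern t \<eta> * exp (c * \<eta>) * (y * shock t \<eta>) powr (q - 1))"
  show ?thesis
  proof (rule Bochner_Integration.integrable_bound[where f = ?g])
    show "integrable lborel ?g"
      by (intro integrable_mult_right Bochner_Integration.integrable_add smooth_powr assms)
    show "AE \<eta> in lborel. norm (kern t \<eta> * exp (c * \<eta>) * f (y * shock t \<eta>)) \<le> norm (?g \<eta>)"
    proof (rule AE_I2)
      fix \<eta>
      have "\<bar>f (y * shock t \<eta>)\<bar> \<le> C * ((y * shock t \<eta>) powr (p - 1) + (y * shock t \<eta>) powr (q - 1))"
        by (rule b) (use assms shock_pos in auto)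
      hence "kern t \<eta> * exp (c * \<eta>) * \<bar>f (y * shock t \<eta>)\<bar> \<le>
        kern t \<eta> * exp (c * \<eta>) * (C * ((y * shock t \<eta>) powr (p - 1) + (y * shock t \<eta>) powr (q - 1)))"
        by (intro mult_left_mono) (use kern_pos[of t \<eta>] in auto)
      thus "norm (kern t \<eta> * exp (c * \<eta>) * f (y * shock t \<eta>)) \<le> norm (?g \<eta>)"
        using kern_pos[of t \<eta>] C by (simp add: abs_mult algebra_simps)
    qed
  qed (use kern_integrand_measurable[OF c assms(2)] in simp)
qed

lemma integrable_kern:
  assumes "power_bounded f" "y > 0" "t \<ge> 0"
  shows "integrable lborel (\<lambda>\<eta>. kern t \<eta> * f (y * shock t \<eta>))"
  using integrable_kern_exp[OF assms, of 0] by simp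

lemma smooth_mono:
  assumes "power_bounded f" "power_bounded g" "y > 0" "t \<ge> 0" "\<And>z. z > 0 \<Longrightarrow> f z \<le> g z"
  shows "smooth f y t \<le> smooth g y t"
  unfolding smooth_def
  by (intro integral_mono integrable_kern mult_left_mono assms(5))
    (use assms shock_pos less_imp_le[OF kern_pos] in auto)

lemma smooth_add:
  assumes "power_bounded f" "power_bounded g" "y > 0" "t \<ge> 0"
  shows "smooth (\<lambda>z. f z + g z) y t = smooth f y t + smooth g y t"
  unfolding smooth_def distrib_left
  by (intro Bochner_Integration.integral_add integrable_kern assms)

lemma smooth_cmult: "smooth (\<lambda>z. c * f z) y t = c * smooth f y t"
  unfolding smooth_def integral_mult_right_zero[symmetric] by (simp add: mult_ac)

text \<open>The eigenvalue at \<open>q = 1\<close>: the kernel has total mass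
  \<open>exp (- r * t)\<close>, so it discounts at the riskless rate.\<close>

lemma smooth_const:
  assumes "y > 0" "t \<ge> 0"
  shows "smooth (\<lambda>z. c) y t = c * exp (- r * t)"
proof -
  \<comment> \<open>A zeroth \<open>powr\<close> equals 1 only at nonzero arguments, hence the
    appeal to positivity of the shock.\<close>
  have "smooth (\<lambda>z. 1) y t = smooth (\<lambda>z. z powr (1 - 1)) y t"
    unfolding smooth_def using assms shock_pos[of t] by (intro Bochner_Integration.integral_cong) (auto simp: less_imp_neq[OF shock_pos, symmetric])
  also have "\<dots> = exp (- r * t)" using smooth_powr(2)[OF assms, of 1] assms growth_1 by simp
  finally have "smooth (\<lambda>z. c * 1) y t = c * exp (- r * t)" by (simp only: smooth_cmult)
  thus ?thesis by simp
qed

lemma smooth_nonneg: "(\<And>z. z > 0 \<Longrightarrow> f z \<ge> 0) \<Longrightarrow> y > 0 \<Longrightarrow> smooth f y t \<ge> 0"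
  unfolding smooth_def using kern_pos shock_pos
  by (intro Bochner_Integration.integral_nonneg) (auto intro!: mult_nonneg_nonneg less_imp_le[OF kern_pos])

lemma smooth_dilate: "smooth f (c * y) t = smooth (\<lambda>z. f (c * z)) y t"
  by (simp add: smooth_def mult_ac)

lemma smooth_abs_le:
  assumes "power_bounded f" "C \<ge> 0" "p \<le> 1" "q \<le> 1" "y > 0" "t \<ge> 0"
    and b: "\<And>z. z > 0 \<Longrightarrow> \<bar>f z\<bar> \<le> C * (z powr (p - 1) + z powr (q - 1))"
  shows "\<bar>smooth f y t\<bar> \<le> C * (y powr (p - 1) * exp (growth p * t) + y powr (q - 1) * exp (growth q * t))"
proof -
  let ?g = "\<lambda>z. C * (z powr (p - 1) + z powr (q - 1))"
  have g: "power_bounded ?g"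
    by (intro power_bounded_cmult power_bounded_add power_bounded_powr assms)
  have eq: "smooth ?g y t = C * (y powr (p - 1) * exp (growth p * t) + y powr (q - 1) * exp (growth q * t))"
    using assms by (simp add: smooth_cmult smooth_add power_bounded_powr smooth_powr(2))
  have "smooth f y t \<le> smooth ?g y t"
    by (rule smooth_mono) (use assms g b in \<open>auto simp: abs_le_iff\<close>)
  moreover have "smooth (\<lambda>z. (-1) * f z) y t \<le> smooth ?g y t"
    by (rule smooth_mono[OF power_bounded_cmult]) (use assms g b in \<open>auto simp: abs_le_iff\<close>)
  ultimately show ?thesis unfolding smooth_cmult[of "-1"] eq by linarith
qed

lemma smooth_measurable:
  assumes "continuous_on {0<..} f" "y > 0"
  shows "smooth f y \<in> borel_measurable borel"
proof -
  \<comment> \<open>Joint continuity holds on the whole plane, since \<open>sqrt\<close> is extended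
    to negative numbers as an odd continuous function.\<close>
  have "continuous_on UNIV (\<lambda>x. case x of (t, \<eta>) \<Rightarrow> kern t \<eta> * f (y * shock t \<eta>))"
    unfolding kern_def shock_def split_def
    by (intro continuous_intros continuous_on_compose2[OF assms(1)]) (use assms in auto)
  hence "(\<lambda>x. case x of (t, \<eta>) \<Rightarrow> kern t \<eta> * f (y * shock t \<eta>)) \<in> borel_measurable borel"
    by (rule borel_measurable_continuous_onI)
  hence "(\<lambda>x. case x of (t, \<eta>) \<Rightarrow> kern t \<eta> * f (y * shock t \<eta>)) \<in> borel_measurable (borel \<Otimes>\<^sub>M lborel)"
    by (simp add: borel_prod[symmetric] cong: measurable_cong_sets)
  from lborel.borel_measurable_lebesgue_integral[OF this]
  show ?thesis by (simp add: smooth_def[abs_def])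
qed

lemma set_integrable_smooth:
  assumes "power_bounded f" "y > 0" "t \<ge> 0"
  shows "set_integrable lborel {0..t} (smooth f y)"
proof -
  obtain C p q where c: "continuous_on {0<..} f" and C: "p \<le> 1" "q \<le> 1" "C \<ge> 0"
    and b: "\<And>z. z > 0 \<Longrightarrow> \<bar>f z\<bar> \<le> C * (z powr (p - 1) + z powr (q - 1))"
    using assms(1) unfolding power_bounded_def by blast
  let ?g = "\<lambda>\<tau>. C * (y powr (p - 1) * exp (growth p * \<tau>) + y powr (q - 1) * exp (growth q * \<tau>))"
  show ?thesis
  proof (rule set_integrable_bound[where f = ?g])
    show "set_integrable lborel {0..t} ?g"
      by (rule borel_integrable_atLeastAtMost') (auto intro!: continuous_intros)
    show "set_borel_measurable lborel {0..t} (smooth f y)"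
      unfolding set_borel_measurable_def using smooth_measurable[OF c assms(2)] by simp
    show "AE \<tau> in lborel. \<tau> \<in> {0..t} \<longrightarrow> norm (smooth f y \<tau>) \<le> norm (?g \<tau>)"
    proof (intro AE_I2 impI)
      fix \<tau> assume "\<tau> \<in> {0..t}"
      hence "\<bar>smooth f y \<tau>\<bar> \<le> ?g \<tau>" by (intro smooth_abs_le assms C b) auto
      thus "norm (smooth f y \<tau>) \<le> norm (?g \<tau>)" by simp
    qed
  qed
qed

lemma cumul_mono:
  assumes "power_bounded f" "power_bounded g" "y > 0" "t \<ge> 0" "\<And>z. z > 0 \<Longrightarrow> f z \<le> g z"
  shows "cumul f y t \<le> cumul g y t"
  unfolding cumul_def
  by (intro set_integral_mono set_integrable_smooth smooth_mono) (use assms in auto)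

lemma cumul_add:
  assumes "power_bounded f" "power_bounded g" "y > 0" "t \<ge> 0"
  shows "cumul (\<lambda>z. f z + g z) y t = cumul f y t + cumul g y t"
proof -
  have "cumul (\<lambda>z. f z + g z) y t = (LBINT \<tau>:{0..t}. smooth f y \<tau> + smooth g y \<tau>)"
    unfolding cumul_def by (intro set_lebesgue_integral_cong) (use assms smooth_add in auto)
  also have "\<dots> = cumul f y t + cumul g y t"
    unfolding cumul_def by (intro set_integral_add set_integrable_smooth assms)
  finally show ?thesis .
qed

lemma cumul_cmult: "cumul (\<lambda>z. c * f z) y t = c * cumul f y t"
  by (simp add: cumul_def smooth_cmult)

lemma cumul_dilate: "cumul f (c * y) t = cumul (\<lambda>z. f (c * z)) y t"
  unfolding cumul_def smooth_dilate ..

lemma cumul_nonneg: "(\<And>z. z > 0 \<Longrightarrow> f z \<ge> 0) \<Longrightarrow> y > 0 \<Longrightarrow> cumul f y t \<ge> 0"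
  unfolding cumul_def set_lebesgue_integral_def
  by (intro Bochner_Integration.integral_nonneg) (auto simp: smooth_nonneg indicator_def)

lemma cumul_powr:
  assumes "y > 0" "t \<ge> 0" "growth q \<noteq> 0"
  shows "cumul (\<lambda>z. z powr (q - 1)) y t = y powr (q - 1) * ((exp (growth q * t) - 1) / growth q)"
proof -
  have "cumul (\<lambda>z. z powr (q - 1)) y t = (LBINT \<tau>:{0..t}. y powr (q - 1) * exp (growth q * \<tau>))"
    unfolding cumul_def using assms
    by (intro set_lebesgue_integral_cong) (auto simp: smooth_powr)
  thus ?thesis using assms by (simp add: set_integral_exp)
qed

lemma cumul_const:
  assumes "y > 0" "t \<ge> 0"
  shows "cumul (\<lambda>z. c) y t = c * ((1 - exp (- r * t)) / r)"
proof -
  have "cumul (\<lambda>z. c) y t = (LBINT \<tau>:{0..t}. c * exp (- r * \<tau>))"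
    unfolding cumul_def using assms
    by (intro set_lebesgue_integral_cong) (auto simp: smooth_const)
  also have "\<dots> = c * ((exp (- r * t) - 1) / (- r))"
    using assms r_pos by (simp only: set_integral_mult_right set_integral_exp)
  finally show ?thesis using r_pos by (simp add: field_simps)
qed

text \<open>The score of the kernel: minus the derivative of \<open>ln (kern t \<eta>)\<close> in
  \<open>\<eta>\<close>, divided by \<open>a * sqrt t\<close>. It is the exponent per unit of
  \<open>h\<close> when \<open>y\<close> is replaced by \<open>y * exp h\<close>.\<close>

definition tilt :: "real \<Rightarrow> real \<Rightarrow> real" where
  "tilt t \<eta> = \<eta> / (2 * (a * sqrt t)) + (\<alpha> - 1)"

text \<open>The derivative of \<open>smooth f y t\<close> with respect to \<open>ln y\<close>; the
  derivative in \<open>y\<close> itself carries a further factor \<open>1 / y\<close>.\<close>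

definition smooth' :: "(real \<Rightarrow> real) \<Rightarrow> real \<Rightarrow> real \<Rightarrow> real" where
  "smooth' f y t = (LBINT \<eta>. kern t \<eta> * tilt t \<eta> * f (y * shock t \<eta>))"

lemma integrable_kern_tilt_exp:
  assumes "power_bounded f" "y > 0" "t \<ge> 0"
  shows "integrable lborel (\<lambda>\<eta>. kern t \<eta> * exp (c * tilt t \<eta>) * f (y * shock t \<eta>))"
proof -
  have eq: "kern t \<eta> * exp (c * tilt t \<eta>) * f (y * shock t \<eta>) =
     exp (c * (\<alpha> - 1)) * (kern t \<eta> * exp (c / (2 * (a * sqrt t)) * \<eta>) * f (y * shock t \<eta>))" for \<eta>
    by (simp add: tilt_def distrib_left exp_add)
  show ?thesis unfolding eq by (intro integrable_mult_right integrable_kern_exp assms)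
qed

text \<open>Translating \<open>\<eta>\<close> by \<open>- h / (a * sqrt t)\<close> cancels
  \<open>exp h\<close> in the argument of \<open>f\<close>. The dependence on \<open>h\<close>
  becomes a Laplace transform times a Gaussian factor that tends to 1 for large
  \<open>t\<close>.\<close>

lemma smooth_shift:
  assumes "t > 0" "y > 0"
  shows "smooth f (y * exp h) t =
    exp (- (h\<^sup>2 / (4 * a\<^sup>2 * t))) * (LBINT \<eta>. kern t \<eta> * exp (h * tilt t \<eta>) * f (y * shock t \<eta>))"
proof -
  define s where "s = a * sqrt t"
  have s: "s \<noteq> 0" "s\<^sup>2 = a\<^sup>2 * t" using assms a_nz by (auto simp: s_def power_mult_distrib)
  have kern: "kern t (- (h / s) + 1 * \<eta>) = kern t \<eta> * exp (h * tilt t \<eta>) * exp (- (h\<^sup>2 / (4 * s\<^sup>2)))" for \<eta>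
  proof -
    have "- ((- (h / s) + \<eta>)\<^sup>2 / 4) - (\<alpha> - 1) * s * (- (h / s) + \<eta>) =
      - (\<eta>\<^sup>2 / 4) - (\<alpha> - 1) * s * \<eta> + h * (\<eta> / (2 * s) + (\<alpha> - 1)) + - (h\<^sup>2 / (4 * s\<^sup>2))"
      using s(1) by (simp add: power2_eq_square field_simps)
    hence "exp (- ((- (h / s) + \<eta>)\<^sup>2 / 4) - (\<alpha> - 1) * s * (- (h / s) + \<eta>)) =
      exp (- (\<eta>\<^sup>2 / 4) - (\<alpha> - 1) * s * \<eta>) * exp (h * (\<eta> / (2 * s) + (\<alpha> - 1))) * exp (- (h\<^sup>2 / (4 * s\<^sup>2)))"
      by (simp only: exp_add)
    thus ?thesis by (simp add: kern_def tilt_def s_def mult.assoc)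
  qed
  have shock: "y * exp h * shock t (- (h / s) + 1 * \<eta>) = y * shock t \<eta>" for \<eta>
  proof -
    have "exp h * exp (s * (- (h / s) + 1 * \<eta>)) = exp (s * \<eta>)"
      using s(1) by (simp add: exp_add[symmetric] field_simps)
    thus ?thesis unfolding shock_def s_def by (simp add: mult.assoc)
  qed
  have "smooth f (y * exp h) t =
    (LBINT \<eta>. kern t (- (h / s) + 1 * \<eta>) * f (y * exp h * shock t (- (h / s) + 1 * \<eta>)))"
    unfolding smooth_def by (subst lborel_integral_real_affine[of 1 _ "- (h / s)"]) auto
  also have "\<dots> = (LBINT \<eta>. exp (- (h\<^sup>2 / (4 * s\<^sup>2))) * (kern t \<eta> * exp (h * tilt t \<eta>) * f (y * shock t \<eta>)))"
    unfolding kern shock by (simp add: mult_ac)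
  finally show ?thesis by (simp add: s mult.assoc)
qed

lemma smooth_shift_deriv:
  assumes f: "power_bounded f" and "y > 0" "t > 0"
  shows "((\<lambda>h. LBINT \<eta>. kern t \<eta> * exp (h * tilt t \<eta>) * f (y * shock t \<eta>))
     has_real_derivative smooth' f y t) (at 0)"
proof -
  have "((\<lambda>h. LBINT \<eta>. kern t \<eta> * exp (h * tilt t \<eta>) * f (y * shock t \<eta>)) has_real_derivative
     (LBINT \<eta>. kern t \<eta> * (tilt t \<eta> * exp (0 * tilt t \<eta>)) * f (y * shock t \<eta>))) (at 0)"
  proof (rule has_real_derivative_lebesgue_integral[where S = "{-1<..<1}" and
      f' = "\<lambda>h \<eta>. kern t \<eta> * (tilt t \<eta> * exp (h * tilt t \<eta>)) * f (y * shock t \<eta>)" and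
      g = "\<lambda>\<eta>. \<bar>kern t \<eta> * exp (2 * tilt t \<eta>) * f (y * shock t \<eta>)\<bar> +
               \<bar>kern t \<eta> * exp (- 2 * tilt t \<eta>) * f (y * shock t \<eta>)\<bar>"])
    fix h \<eta> :: real assume h: "h \<in> {-1<..<1}"
    show "((\<lambda>h. kern t \<eta> * exp (h * tilt t \<eta>) * f (y * shock t \<eta>)) has_real_derivative
         kern t \<eta> * (tilt t \<eta> * exp (h * tilt t \<eta>)) * f (y * shock t \<eta>)) (at h)"
      by (auto intro!: derivative_eq_intros)
    have "\<bar>tilt t \<eta> * exp (h * tilt t \<eta>)\<bar> \<le> exp (2 * tilt t \<eta>) + exp (- 2 * tilt t \<eta>)"
      using h by (intro abs_exp_le) auto
    hence "kern t \<eta> * \<bar>tilt t \<eta> * exp (h * tilt t \<eta>)\<bar> * \<bar>f (y * shock t \<eta>)\<bar> \<le>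
       kern t \<eta> * (exp (2 * tilt t \<eta>) + exp (- 2 * tilt t \<eta>)) * \<bar>f (y * shock t \<eta>)\<bar>"
      using kern_pos[of t \<eta>] by (intro mult_right_mono mult_left_mono) auto
    thus "\<bar>kern t \<eta> * (tilt t \<eta> * exp (h * tilt t \<eta>)) * f (y * shock t \<eta>)\<bar> \<le>
       \<bar>kern t \<eta> * exp (2 * tilt t \<eta>) * f (y * shock t \<eta>)\<bar> +
       \<bar>kern t \<eta> * exp (- 2 * tilt t \<eta>) * f (y * shock t \<eta>)\<bar>"
      using kern_pos[of t \<eta>] by (simp add: abs_mult algebra_simps)
  next
    show "integrable lborel (\<lambda>\<eta>. \<bar>kern t \<eta> * exp (2 * tilt t \<eta>) * f (y * shock t \<eta>)\<bar> +
        \<bar>kern t \<eta> * exp (- 2 * tilt t \<eta>) * f (y * shock t \<eta>)\<bar>)"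
      by (intro Bochner_Integration.integrable_add integrable_abs integrable_kern_tilt_exp)
        (use assms in auto)
  qed (use assms in \<open>auto intro!: integrable_kern_tilt_exp\<close>)
  thus ?thesis by (simp add: smooth'_def)
qed

text \<open>Shifting \<open>\<eta>\<close> puts the logarithm of \<open>y\<close> into the Gaussian weight, so that no smoothness of
  \<open>f\<close> is needed.\<close>

lemma smooth_has_derivative:
  assumes f: "power_bounded f" and y: "y > 0" and t: "t > 0"
  shows "((\<lambda>z. smooth f z t) has_real_derivative smooth' f y t / y) (at y)"
proof -
  let ?M = "\<lambda>h. LBINT \<eta>. kern t \<eta> * exp (h * tilt t \<eta>) * f (y * shock t \<eta>)"
  let ?G = "\<lambda>h. exp (- (h\<^sup>2 / (4 * a\<^sup>2 * t))) * ?M h"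
  \<comment> \<open>The Gaussian factor is even in \<open>h\<close> and equals 1 at 0, so it does
    not contribute to the derivative there.\<close>
  have "((\<lambda>h. exp (- (h\<^sup>2 / (4 * a\<^sup>2 * t)))) has_real_derivative 0) (at 0)"
    using t a_nz by (auto intro!: derivative_eq_intros)
  from DERIV_mult[OF this smooth_shift_deriv[OF f y t]]
  have G: "(?G has_real_derivative smooth' f y t) (at 0)" by simp
  have "((\<lambda>z. ln z - ln y) has_real_derivative 1 / y) (at y)"
    using y by (auto intro!: derivative_eq_intros)
  from DERIV_chain2[OF _ this, of ?G "smooth' f y t"] G
  have "((\<lambda>z. ?G (ln z - ln y)) has_real_derivative smooth' f y t * (1 / y)) (at y)" by simp
  hence "((\<lambda>z. smooth f z t) has_real_derivative smooth' f y t * (1 / y)) (at y)"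
  proof (rule has_field_derivative_transform_within_open[where S = "{0<..}"])
    fix z :: real assume "z \<in> {0<..}"
    hence z: "z > 0" by simp
    have "y * exp (ln z - ln y) = z" using y z by (simp add: exp_diff)
    thus "?G (ln z - ln y) = smooth f z t"
      using smooth_shift[OF t y, of f "ln z - ln y"] by simp
  qed (use y in auto)
  thus ?thesis by simp
qed

text \<open>This is \<open>exp (h l) \<ge> 1 + h l\<close> under the integral: up to the vanishing factor
  \<open>exp (h\<^sup>2 / (4 a\<^sup>2 t))\<close>, finite differences of both signs bound the derivative.\<close>

lemma smooth'_le_difference:
  assumes f: "power_bounded f" and y: "y > 0" and t: "t > 0" and nn: "\<And>z. z > 0 \<Longrightarrow> f z \<ge> 0"
  shows "h * smooth' f y t \<le> exp (h\<^sup>2 / (4 * a\<^sup>2 * t)) * smooth f (y * exp h) t - smooth f y t"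
proof -
  let ?m = "\<lambda>h \<eta>. kern t \<eta> * exp (h * tilt t \<eta>) * f (y * shock t \<eta>)"
  let ?m' = "\<lambda>\<eta>. kern t \<eta> * tilt t \<eta> * f (y * shock t \<eta>)"
  have i: "integrable lborel (?m h)" for h
    by (rule integrable_kern_tilt_exp) (use assms in auto)
  have i0: "integrable lborel (\<lambda>\<eta>. kern t \<eta> * f (y * shock t \<eta>))"
    by (rule integrable_kern) (use assms in auto)
  have i': "integrable lborel ?m'"
  proof (rule Bochner_Integration.integrable_bound[where f = "\<lambda>\<eta>. \<bar>?m 2 \<eta>\<bar> + \<bar>?m (- 2) \<eta>\<bar>"])
    have "continuous_on {0<..} f" using f by (simp add: power_bounded_def)
    hence "(\<lambda>\<eta>. kern t \<eta> * exp (0 * \<eta>) * f (y * shock t \<eta>)) \<in> borel_measurable borel"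
      by (rule kern_integrand_measurable[OF _ y])
    hence "(\<lambda>\<eta>. tilt t \<eta> * (kern t \<eta> * exp (0 * \<eta>) * f (y * shock t \<eta>))) \<in> borel_measurable borel"
      unfolding tilt_def by measurable
    thus "?m' \<in> borel_measurable lborel" by (simp add: mult_ac)
    show "AE \<eta> in lborel. norm (?m' \<eta>) \<le> norm (\<bar>?m 2 \<eta>\<bar> + \<bar>?m (- 2) \<eta>\<bar>)"
    proof (rule AE_I2)
      fix \<eta>
      have "\<bar>tilt t \<eta>\<bar> \<le> exp (2 * tilt t \<eta>) + exp (- 2 * tilt t \<eta>)"
        using abs_exp_le[of 0] by simp
      hence "kern t \<eta> * \<bar>tilt t \<eta>\<bar> * \<bar>f (y * shock t \<eta>)\<bar> \<le>
         kern t \<eta> * (exp (2 * tilt t \<eta>) + exp (- 2 * tilt t \<eta>)) * \<bar>f (y * shock t \<eta>)\<bar>"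
        using kern_pos[of t \<eta>] by (intro mult_right_mono mult_left_mono) auto
      thus "norm (?m' \<eta>) \<le> norm (\<bar>?m 2 \<eta>\<bar> + \<bar>?m (- 2) \<eta>\<bar>)"
        using kern_pos[of t \<eta>] by (simp add: abs_mult algebra_simps)
    qed
  qed (intro Bochner_Integration.integrable_add integrable_abs i)
  have "smooth f y t + h * smooth' f y t = (LBINT \<eta>. kern t \<eta> * f (y * shock t \<eta>) + h * ?m' \<eta>)"
    unfolding smooth_def smooth'_def
    by (subst Bochner_Integration.integral_add[OF i0 integrable_mult_right[OF i']]) simp
  also have "\<dots> \<le> (LBINT \<eta>. ?m h \<eta>)"
  proof (rule integral_mono)
    fix \<eta>
    have "(kern t \<eta> * f (y * shock t \<eta>)) * (1 + h * tilt t \<eta>) \<le>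
      (kern t \<eta> * f (y * shock t \<eta>)) * exp (h * tilt t \<eta>)"
      by (rule mult_left_mono)
        (use nn y shock_pos[of t \<eta>] kern_pos[of t \<eta>] in \<open>auto intro!: mult_nonneg_nonneg exp_ge_add_one_self\<close>)
    thus "kern t \<eta> * f (y * shock t \<eta>) + h * ?m' \<eta> \<le> ?m h \<eta>"
      by (simp add: algebra_simps)
  qed (intro Bochner_Integration.integrable_add integrable_mult_right i i' i0)+
  also have "\<dots> = exp (h\<^sup>2 / (4 * a\<^sup>2 * t)) * smooth f (y * exp h) t"
    unfolding smooth_shift[OF t y] by (simp add: mult.assoc[symmetric] exp_add[symmetric])
  finally show ?thesis by simp
qed

text \<open>Differentiating \<open>f\<close> instead of the kernel avoids the singularity \<open>1 / sqrt t\<close> of the kernel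
  derivative at \<open>t = 0\<close>, so that the bound can be integrated in time.\<close>

lemma smooth_has_derivative_elasticity:
  assumes f: "power_bounded f" and h: "power_bounded h"
    and der: "\<And>z. z > 0 \<Longrightarrow> (f has_real_derivative - (h z / z)) (at z)"
    and y: "y > 0" and t: "t \<ge> 0"
  shows "((\<lambda>z. smooth f z t) has_real_derivative - (smooth h y t / y)) (at y)"
proof -
  from power_bounded_interval_bound[OF h y] obtain C p q where C: "p \<le> 1" "q \<le> 1" "C \<ge> 0"
    and b: "\<And>z w. \<lbrakk>y / 2 < z; w > 0\<rbrakk> \<Longrightarrow>
      \<bar>h (z * w)\<bar> \<le> C * ((y / 2 * w) powr (p - 1) + (y / 2 * w) powr (q - 1))" by metis
  let ?B = "\<lambda>\<eta>. C * ((y / 2 * shock t \<eta>) powr (p - 1) + (y / 2 * shock t \<eta>) powr (q - 1))"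
  have "((\<lambda>z. LBINT \<eta>. kern t \<eta> * f (z * shock t \<eta>)) has_real_derivative
     (LBINT \<eta>. - (kern t \<eta> * h (y * shock t \<eta>) / y))) (at y)"
  proof (rule has_real_derivative_lebesgue_integral[where S = "{y / 2<..<2 * y}" and
      f' = "\<lambda>z \<eta>. - (kern t \<eta> * h (z * shock t \<eta>) / z)" and
      g = "\<lambda>\<eta>. 2 / y * (kern t \<eta> * ?B \<eta>)"])
    fix z \<eta> :: real assume "z \<in> {y / 2<..<2 * y}"
    hence z: "y / 2 < z" "z > 0" using y by auto
    show "integrable lborel (\<lambda>\<eta>. kern t \<eta> * f (z * shock t \<eta>))"
      by (rule integrable_kern) (use f t z in auto)
    have "((\<lambda>z. f (z * shock t \<eta>)) has_real_derivative
        - (h (z * shock t \<eta>) / (z * shock t \<eta>)) * shock t \<eta>) (at z)"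
      by (rule DERIV_chain2[OF der]) (use z shock_pos[of t \<eta>] in \<open>auto intro!: derivative_eq_intros\<close>)
    hence "((\<lambda>z. kern t \<eta> * f (z * shock t \<eta>)) has_real_derivative
        kern t \<eta> * (- (h (z * shock t \<eta>) / (z * shock t \<eta>)) * shock t \<eta>)) (at z)"
      by (rule DERIV_cmult)
    thus "((\<lambda>z. kern t \<eta> * f (z * shock t \<eta>)) has_real_derivative
        - (kern t \<eta> * h (z * shock t \<eta>) / z)) (at z)"
      using shock_pos[of t \<eta>] by simp
    have "\<bar>h (z * shock t \<eta>)\<bar> / z \<le> ?B \<eta> / (y / 2)"
      using b[OF z(1) shock_pos, of t \<eta>] z y by (intro frac_le) auto
    hence le: "kern t \<eta> * (\<bar>h (z * shock t \<eta>)\<bar> / z) \<le> kern t \<eta> * (?B \<eta> / (y / 2))"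
      using kern_pos[of t \<eta>] by (intro mult_left_mono) auto
    show "\<bar>- (kern t \<eta> * h (z * shock t \<eta>) / z)\<bar> \<le> 2 / y * (kern t \<eta> * ?B \<eta>)"
    proof -
      have "\<bar>- (kern t \<eta> * h (z * shock t \<eta>) / z)\<bar> = kern t \<eta> * (\<bar>h (z * shock t \<eta>)\<bar> / z)"
        using kern_pos[of t \<eta>] z by (simp add: abs_mult)
      moreover have "k * (B / (y / 2)) = 2 / y * (k * B)" for k B by simp
      ultimately show ?thesis using le by metis
    qed
  next
    have "integrable lborel (\<lambda>\<eta>. kern t \<eta> * ?B \<eta>)"
      using integrable_kern[OF power_bounded_cmult[OF power_bounded_add[OF power_bounded_powr[OF C(1)]
            power_bounded_powr[OF C(2)]], of C], of "y / 2" t] y t by simp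
    thus "integrable lborel (\<lambda>\<eta>. 2 / y * (kern t \<eta> * ?B \<eta>))" by (rule integrable_mult_right)
  qed (use y in auto)
  thus ?thesis by (simp add: smooth_def)
qed

text \<open>For \<open>z > y / 2\<close> the nonpositive powers in \<open>smooth_abs_le\<close> are
  at most their values at \<open>y / 2\<close>, which leaves a majorant in time that is a sum of
  exponentials, integrable on \<open>[0, t]\<close>.\<close>

lemma cumul_has_derivative:
  assumes f: "power_bounded f" and h: "power_bounded h"
    and der: "\<And>z. z > 0 \<Longrightarrow> (f has_real_derivative - (h z / z)) (at z)"
    and y: "y > 0" and t: "t \<ge> 0"
  shows "((\<lambda>z. cumul f z t) has_real_derivative - (cumul h y t / y)) (at y)"
proof -
  from power_bounded_interval_bound[OF h y] obtain C p q where C: "p \<le> 1" "q \<le> 1" "C \<ge> 0"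
    and b: "\<And>z. z > 0 \<Longrightarrow> \<bar>h z\<bar> \<le> C * (z powr (p - 1) + z powr (q - 1))" by metis
  let ?B = "\<lambda>\<tau>. C * ((y / 2) powr (p - 1) * exp (growth p * \<tau>) + (y / 2) powr (q - 1) * exp (growth q * \<tau>))"
  have "((\<lambda>z. LBINT \<tau>. indicator {0..t} \<tau> * smooth f z \<tau>) has_real_derivative
     (LBINT \<tau>. - (indicator {0..t} \<tau> * smooth h y \<tau> / y))) (at y)"
  proof (rule has_real_derivative_lebesgue_integral[where S = "{y / 2<..<2 * y}" and
      f' = "\<lambda>z \<tau>. - (indicator {0..t} \<tau> * smooth h z \<tau> / z)" and
      g = "\<lambda>\<tau>. 2 / y * (indicator {0..t} \<tau> * ?B \<tau>)"])
    fix z \<tau> :: real assume "z \<in> {y / 2<..<2 * y}"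
    hence z: "y / 2 < z" "z > 0" using y by auto
    show "integrable lborel (\<lambda>\<tau>. indicator {0..t} \<tau> * smooth f z \<tau>)"
      using set_integrable_smooth[OF f z(2) t] by (simp add: set_integrable_def)
    show "((\<lambda>z. indicator {0..t} \<tau> * smooth f z \<tau>) has_real_derivative
        - (indicator {0..t} \<tau> * smooth h z \<tau> / z)) (at z)"
      using smooth_has_derivative_elasticity[OF f h der z(2), of \<tau>] by (auto simp: indicator_def)
    show "\<bar>- (indicator {0..t} \<tau> * smooth h z \<tau> / z)\<bar> \<le> 2 / y * (indicator {0..t} \<tau> * ?B \<tau>)"
    proof (cases "\<tau> \<in> {0..t}")
      case True
      have "\<bar>smooth h z \<tau>\<bar> \<le> C * (z powr (p - 1) * exp (growth p * \<tau>) + z powr (q - 1) * exp (growth q * \<tau>))"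
        by (rule smooth_abs_le) (use h C z True b in auto)
      also have "\<dots> \<le> ?B \<tau>"
        using C z y by (intro mult_left_mono add_mono mult_right_mono powr_mono2') auto
      finally have "\<bar>smooth h z \<tau>\<bar> / z \<le> ?B \<tau> / (y / 2)" using z y by (intro frac_le) auto
      thus ?thesis using True z by (simp add: mult_ac)
    qed auto
  next
    have "set_integrable lborel {0..t} ?B"
      by (rule borel_integrable_atLeastAtMost') (auto intro!: continuous_intros)
    hence "integrable lborel (\<lambda>\<tau>. indicator {0..t} \<tau> * ?B \<tau>)" by (simp add: set_integrable_def)
    thus "integrable lborel (\<lambda>\<tau>. 2 / y * (indicator {0..t} \<tau> * ?B \<tau>))" by (rule integrable_mult_right)
  qed (use y in auto)
  thus ?thesis by (simp add: cumul_def set_lebesgue_integral_def)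
qed

end

section \<open>Distant-horizon asymptotics\<close>

text \<open>To be read with \<open>J1\<close>, \<open>J2\<close> the absolute derivatives of
  \<open>V1\<close>, \<open>V2\<close>, with \<open>h z\<close> equal to \<open>z\<close> times the
  second derivative of \<open>V2\<close>, with \<open>s\<close> the exponent of the growth condition
  and \<open>D\<close> the tail constant obtained by integrating it.\<close>

locale dual_marginals = merton r \<delta> \<theta> for r \<delta> \<theta> +
  fixes J1 J2 h :: "real \<Rightarrow> real" and q1 q2 s D K :: real
  assumes q1: "q1 < q_star r \<delta> \<theta>" and q2: "q2 < q_star r \<delta> \<theta>"
    and s: "0 < s" "s < 1"
    and J1_cont: "continuous_on {0<..} J1"
    and J1_nonneg: "\<And>z. 0 < z \<Longrightarrow> 0 \<le> J1 z"
    and J1_anti: "\<And>x y. 0 < x \<Longrightarrow> x \<le> y \<Longrightarrow> J1 y \<le> J1 x"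
    and J1_regvar: "\<And>x. x > 0 \<Longrightarrow> ((\<lambda>y. J1 (x * y) / J1 y) \<longlongrightarrow> x powr (q1 - 1)) (at_right 0)"
    and J2_nonneg: "\<And>z. 0 < z \<Longrightarrow> 0 \<le> J2 z"
    and J2_anti: "\<And>x y. 0 < x \<Longrightarrow> x \<le> y \<Longrightarrow> J2 y \<le> J2 x"
    and J2_deriv: "\<And>z. 0 < z \<Longrightarrow> (J2 has_real_derivative - (h z / z)) (at z)"
    and h_cont: "continuous_on {0<..} h"
    and h_nonneg: "\<And>z. 0 < z \<Longrightarrow> 0 \<le> h z"
    and J2_elasticity: "((\<lambda>y. h y / J2 y) \<longlongrightarrow> 1 - q2) (at_right 0)"
    and J2_tail: "D \<ge> 0" "\<And>z. z \<ge> 1 \<Longrightarrow> J2 z \<le> D * z powr (s - 1)"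
    and h_tail: "K \<ge> 0" "\<And>z. z \<ge> 1 \<Longrightarrow> h z \<le> K * z powr (s - 1)"
begin

section \<open>Global power bounds for the marginals\<close>

lemma q_neg: "q1 < 0" "q2 < 0"
  using q1 q2 q_star_neg by linarith+

lemma J2_cont: "continuous_on {0<..} J2"
  using J2_deriv by (auto intro!: continuous_at_imp_continuous_on DERIV_isCont)

lemma J1_lower:
  assumes "q1 < p" "p \<le> 1"
  obtains c C where "c > 0" "C \<ge> 0" "\<And>z. z > 0 \<Longrightarrow> c * z powr (p - 1) \<le> J1 z + C"
proof -
  obtain c z0 where c: "c > 0" "z0 > 0" "\<And>z. 0 < z \<Longrightarrow> z \<le> z0 \<Longrightarrow> c * z powr (p - 1) \<le> J1 z"
    using regvar_lower_bound[OF J1_nonneg J1_anti J1_regvar assms] by blast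
  show ?thesis
    by (rule that[of c "c * z0 powr (p - 1)"])
      (use c assms global_lower_bound[of J1 c z0 p] J1_nonneg in auto)
qed

lemma J2_lower:
  assumes "q2 < p" "p \<le> 1"
  obtains c C where "c > 0" "C \<ge> 0" "\<And>z. z > 0 \<Longrightarrow> c * z powr (p - 1) \<le> J2 z + C"
proof -
  have "q2 < 1" using q_neg by simp
  then obtain c z0 where c: "c > 0" "z0 > 0" "\<And>z. 0 < z \<Longrightarrow> z \<le> z0 \<Longrightarrow> c * z powr (p - 1) \<le> J2 z"
    using elasticity_lower_bound[OF J2_nonneg J2_deriv J2_elasticity assms(1)] by blast
  show ?thesis
    by (rule that[of c "c * z0 powr (p - 1)"])
      (use c assms global_lower_bound[of J2 c z0 p] J2_nonneg in auto)
qed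

text \<open>Monotonicity alone controls \<open>J1\<close> at infinity, hence the constant tail
  (exponent \<open>1 - 1\<close>); \<open>J2_upper\<close> has the decaying tail
  \<open>z powr (s - 1)\<close> instead.\<close>

lemma J1_upper:
  assumes "p < q1"
  obtains E where "E \<ge> 0" "\<And>z. z > 0 \<Longrightarrow> J1 z \<le> E * (z powr (p - 1) + z powr (1 - 1))"
proof -
  have p: "p \<le> 1" using assms q_neg by simp
  obtain C z0 where C: "C \<ge> 0" "z0 > 0" "\<And>z. 0 < z \<Longrightarrow> z \<le> z0 \<Longrightarrow> J1 z \<le> C * z powr (p - 1)"
    using regvar_upper_bound[OF J1_nonneg J1_anti J1_regvar assms p] by blast
  have "J1 z \<le> J1 1 * z powr (1 - 1)" if "z \<ge> 1" for z using J1_anti[of 1 z] that by simp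
  from global_upper_bound[OF J1_anti C J1_nonneg[OF zero_less_one] this p order_refl] that
  show ?thesis by blast
qed

lemma J2_upper:
  assumes "p < q2"
  obtains E where "E \<ge> 0" "\<And>z. z > 0 \<Longrightarrow> J2 z \<le> E * (z powr (p - 1) + z powr (s - 1))"
proof -
  have p: "p \<le> 1" "q2 < 1" using assms q_neg by auto
  obtain C z0 where C: "C \<ge> 0" "z0 > 0" "\<And>z. 0 < z \<Longrightarrow> z \<le> z0 \<Longrightarrow> J2 z \<le> C * z powr (p - 1)"
    using elasticity_upper_bound[OF J2_nonneg J2_deriv J2_elasticity assms p(2)] by blast
  from global_upper_bound[OF J2_anti C J2_tail p(1) less_imp_le[OF s(2)]] that
  show ?thesis by blast
qed

text \<open>The elasticity limit makes the error relative near 0. Away from 0 it is measured by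
  \<open>z powr (s - 1)\<close>, whose cumulated average tends to 0 when \<open>y\<close> tends to
  infinity.\<close>

lemma h_approx:
  assumes "e > 0"
  obtains C where "C \<ge> 0" "\<And>z. z > 0 \<Longrightarrow> \<bar>h z - (1 - q2) * J2 z\<bar> \<le> e * J2 z + C * z powr (s - 1)"
proof -
  have "\<forall>\<^sub>F y in at_right 0. dist (h y / J2 y) (1 - q2) < e"
    by (rule tendstoD[OF J2_elasticity assms])
  moreover have "\<forall>\<^sub>F y in at_right 0. J2 y > 0"
    by (rule ratio_limit_pos[OF J2_elasticity]) (use J2_nonneg q_neg in auto)
  ultimately have "\<forall>\<^sub>F y in at_right 0. \<bar>h y - (1 - q2) * J2 y\<bar> \<le> e * J2 y"
  proof eventually_elim
    case (elim y)
    have "h y - (1 - q2) * J2 y = (h y / J2 y - (1 - q2)) * J2 y" using elim by (simp add: left_diff_distrib)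
    also have "\<bar>\<dots>\<bar> \<le> e * J2 y"
      using elim by (auto simp: abs_mult dist_real_def intro!: mult_right_mono)
    finally show ?case .
  qed
  then obtain z0 where z0: "z0 > 0"
    "\<And>z. 0 < z \<Longrightarrow> z \<le> z0 \<Longrightarrow> \<bar>h z - (1 - q2) * J2 z\<bar> \<le> e * J2 z"
    by (rule eventually_at_right_0_le) auto
  have "compact ((\<lambda>z. h z - (1 - q2) * J2 z) ` {z0..1})"
    by (intro compact_continuous_image continuous_intros continuous_on_subset[OF h_cont]
        continuous_on_subset[OF J2_cont]) (use z0 in auto)
  then obtain M where M: "M > 0" "\<And>z. z \<in> {z0..1} \<Longrightarrow> \<bar>h z - (1 - q2) * J2 z\<bar> \<le> M"
    by (auto dest!: compact_imp_bounded simp: bounded_pos)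
  \<comment> \<open>\<open>M\<close> covers the compact middle range; \<open>K\<close> and
    \<open>(1 - q2) * D\<close> cover the tails of \<open>h\<close> and of
    \<open>(1 - q2) * J2\<close>.\<close>
  define C where "C = M + K + (1 - q2) * D"
  have pos: "0 \<le> (1 - q2) * D" using J2_tail q_neg by simp
  have C0: "C \<ge> 0" using M h_tail pos by (simp add: C_def)
  show ?thesis
  proof (rule that[OF C0])
    fix z :: real assume z: "z > 0"
    have eJ: "0 \<le> e * J2 z" using assms J2_nonneg[OF z] by simp
    have Cz: "0 \<le> C * z powr (s - 1)" using C0 by simp
    consider "z \<le> z0" | "z \<ge> 1" | "z \<in> {z0..1}" by fastforce
    thus "\<bar>h z - (1 - q2) * J2 z\<bar> \<le> e * J2 z + C * z powr (s - 1)"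
    proof cases
      case 1
      thus ?thesis using z0(2)[OF z] Cz by linarith
    next
      case 2
      have "0 \<le> (1 - q2) * J2 z" using J2_nonneg[OF z] q_neg by simp
      moreover have "(1 - q2) * J2 z \<le> (1 - q2) * (D * z powr (s - 1))"
        using J2_tail(2)[OF 2] q_neg by (intro mult_left_mono) auto
      ultimately have "\<bar>h z - (1 - q2) * J2 z\<bar> \<le> K * z powr (s - 1) + (1 - q2) * (D * z powr (s - 1))"
        using h_tail(2)[OF 2] h_nonneg[OF z] by linarith
      also have "\<dots> = (K + (1 - q2) * D) * z powr (s - 1)" by (simp add: algebra_simps)
      also have "\<dots> \<le> C * z powr (s - 1)" using M by (intro mult_right_mono) (auto simp: C_def)
      finally show ?thesis using eJ by linarith
    next
      case 3
      have "1 \<le> z powr (s - 1)" using 3 z s powr_mono2'[of "s - 1" z 1] by auto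
      hence "M * 1 \<le> C * z powr (s - 1)"
        using M h_tail pos C0 by (intro mult_mono) (auto simp: C_def)
      thus ?thesis using M(2)[OF 3] eJ by linarith
    qed
  qed
qed

lemma power_bounded_J1: "power_bounded J1"
proof -
  obtain E where E: "E \<ge> 0" "\<And>z. z > 0 \<Longrightarrow> J1 z \<le> E * (z powr (q1 - 1 - 1) + z powr (1 - 1))"
    using J1_upper[of "q1 - 1"] by auto
  show ?thesis
    by (rule power_boundedI[OF J1_cont, of "q1 - 1" 1 E]) (use E q_neg J1_nonneg in auto)
qed

lemma power_bounded_J2: "power_bounded J2"
proof -
  obtain E where E: "E \<ge> 0" "\<And>z. z > 0 \<Longrightarrow> J2 z \<le> E * (z powr (q2 - 1 - 1) + z powr (s - 1))"
    using J2_upper[of "q2 - 1"] by auto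
  show ?thesis
    by (rule power_boundedI[OF J2_cont, of "q2 - 1" s E]) (use E q_neg s J2_nonneg in auto)
qed

lemma power_bounded_h: "power_bounded h"
proof -
  obtain E where E: "E \<ge> 0" "\<And>z. z > 0 \<Longrightarrow> J2 z \<le> E * (z powr (q2 - 1 - 1) + z powr (s - 1))"
    using J2_upper[of "q2 - 1"] by auto
  obtain C where C: "C \<ge> 0" "\<And>z. z > 0 \<Longrightarrow> \<bar>h z - (1 - q2) * J2 z\<bar> \<le> 1 * J2 z + C * z powr (s - 1)"
    using h_approx[of 1] by auto
  show ?thesis
  proof (rule power_boundedI[OF h_cont, of "q2 - 1" s "(2 - q2) * E + C"])
    fix z :: real assume z: "z > 0"
    have "\<bar>h z\<bar> \<le> (2 - q2) * J2 z + C * z powr (s - 1)"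
      using C(2)[OF z] h_nonneg[OF z] by (simp add: algebra_simps)
    also have "\<dots> \<le> (2 - q2) * (E * (z powr (q2 - 1 - 1) + z powr (s - 1))) +
        C * (z powr (q2 - 1 - 1) + z powr (s - 1))"
      using E C z q_neg by (intro add_mono mult_left_mono) auto
    finally show "\<bar>h z\<bar> \<le> ((2 - q2) * E + C) * (z powr (q2 - 1 - 1) + z powr (s - 1))"
      by (simp add: algebra_simps)
  qed (use E C q_neg s in auto)
qed

section \<open>Wealth as a function of the dual variable, and solvability\<close>

definition W :: "real \<Rightarrow> real \<Rightarrow> real" where
  "W y t = smooth J1 y t + cumul J2 y t"

lemma W_has_derivative:
  assumes "y > 0" "t > 0"
  shows "((\<lambda>z. W z t) has_real_derivative (smooth' J1 y t - cumul h y t) / y) (at y)"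
proof -
  have "((\<lambda>z. W z t) has_real_derivative smooth' J1 y t / y + - (cumul h y t / y)) (at y)"
    unfolding W_def
    by (intro DERIV_add smooth_has_derivative cumul_has_derivative)
      (use assms power_bounded_J1 power_bounded_J2 power_bounded_h J2_deriv in auto)
  thus ?thesis by (simp add: diff_divide_distrib)
qed

text \<open>With \<open>y' = c * y\<close> the dilation moves into the arguments of
  \<open>J1\<close> and \<open>J2\<close>, where monotonicity applies pointwise.\<close>

lemma W_antimono:
  assumes "0 < y" "y \<le> y'" "t \<ge> 0"
  shows "W y' t \<le> W y t"
proof -
  define c where "c = y' / y"
  have c: "c \<ge> 1" "y' = c * y" using assms by (auto simp: c_def)
  have "z \<le> c * z" if "z > 0" for z using c that by simp
  hence "smooth (\<lambda>z. J1 (c * z)) y t \<le> smooth J1 y t" "cumul (\<lambda>z. J2 (c * z)) y t \<le> cumul J2 y t"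
    using assms c power_bounded_J1 power_bounded_J2
    by (auto intro!: smooth_mono cumul_mono power_bounded_dilate J1_anti J2_anti)
  thus ?thesis unfolding W_def c(2) smooth_dilate cumul_dilate by linarith
qed

lemma smooth_J1_lower:
  assumes "c > 0" "\<And>z. z > 0 \<Longrightarrow> c * z powr (p - 1) \<le> J1 z + C" "C \<ge> 0" "p \<le> 1" "y > 0" "t \<ge> 0"
  shows "c * (y powr (p - 1) * exp (growth p * t)) \<le> smooth J1 y t + C"
proof -
  have "smooth (\<lambda>z. c * z powr (p - 1)) y t \<le> smooth (\<lambda>z. J1 z + C) y t"
    using assms by (intro smooth_mono power_bounded_cmult power_bounded_add power_bounded_powr
      power_bounded_J1 power_bounded_const) auto
  hence "c * (y powr (p - 1) * exp (growth p * t)) \<le> smooth J1 y t + C * exp (- r * t)"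
    using assms by (simp add: smooth_cmult smooth_powr smooth_add smooth_const power_bounded_J1 power_bounded_const)
  moreover have "C * exp (- r * t) \<le> C * 1"
    using assms r_pos by (intro mult_left_mono) auto
  ultimately show ?thesis by simp
qed

lemma cumul_J2_lower:
  assumes "c > 0" "\<And>z. z > 0 \<Longrightarrow> c * z powr (p - 1) \<le> J2 z + C" "C \<ge> 0" "p < q_star r \<delta> \<theta>" "y > 0" "t \<ge> 0"
  shows "c * (y powr (p - 1) * ((exp (growth p * t) - 1) / growth p)) \<le> cumul J2 y t + C / r"
proof -
  have g: "growth p > 0" "p \<le> 1" using growth_pos assms q_star_neg by auto
  have "cumul (\<lambda>z. c * z powr (p - 1)) y t \<le> cumul (\<lambda>z. J2 z + C) y t"
    using assms g by (intro cumul_mono power_bounded_cmult power_bounded_add power_bounded_powr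
      power_bounded_J2 power_bounded_const) auto
  hence "c * (y powr (p - 1) * ((exp (growth p * t) - 1) / growth p)) \<le>
      cumul J2 y t + C * ((1 - exp (- r * t)) / r)"
    using assms g by (simp add: cumul_cmult cumul_powr cumul_add cumul_const power_bounded_J2 power_bounded_const)
  moreover have "C * ((1 - exp (- r * t)) / r) \<le> C * (1 / r)"
    using assms r_pos by (intro mult_left_mono divide_right_mono) auto
  ultimately show ?thesis by simp
qed

lemma cumul_powr_s_le:
  assumes "y > 0" "t \<ge> 0"
  shows "cumul (\<lambda>z. z powr (s - 1)) y t \<le> y powr (s - 1) / (- growth s)"
proof -
  have g: "growth s < 0" using growth_neg s by simp
  have "cumul (\<lambda>z. z powr (s - 1)) y t = y powr (s - 1) * ((1 - exp (growth s * t)) / (- growth s))"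
    using g assms by (subst cumul_powr) (auto simp: field_simps)
  also have "\<dots> \<le> y powr (s - 1) * (1 / (- growth s))"
    using g by (intro mult_left_mono divide_right_mono) auto
  finally show ?thesis by simp
qed

lemma smooth_J1_upper:
  assumes "E \<ge> 0" "\<And>z. z > 0 \<Longrightarrow> J1 z \<le> E * (z powr (p - 1) + z powr (1 - 1))" "p < q1" "y > 0" "t \<ge> 0"
  shows "smooth J1 y t \<le> E * (y powr (p - 1) * exp (growth p * t) + exp (- r * t))"
proof -
  have "\<bar>smooth J1 y t\<bar> \<le> E * (y powr (p - 1) * exp (growth p * t) + y powr (1 - 1) * exp (growth 1 * t))"
    by (rule smooth_abs_le[OF power_bounded_J1]) (use assms J1_nonneg q_neg in auto)
  thus ?thesis using assms by (simp add: growth_1)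
qed

lemma cumul_J2_upper:
  assumes "E \<ge> 0" "\<And>z. z > 0 \<Longrightarrow> J2 z \<le> E * (z powr (p - 1) + z powr (s - 1))" "p < q2" "y > 0" "t \<ge> 0"
  shows "cumul J2 y t \<le>
    E * (y powr (p - 1) * exp (growth p * t) / growth p + y powr (s - 1) / (- growth s))"
proof -
  have g: "growth p > 0" "p \<le> 1" using growth_pos assms q2 q_neg by auto
  have "cumul J2 y t \<le> cumul (\<lambda>z. E * (z powr (p - 1) + z powr (s - 1))) y t"
    using assms g s by (intro cumul_mono power_bounded_cmult power_bounded_add power_bounded_powr
      power_bounded_J2) auto
  also have "\<dots> = E * (y powr (p - 1) * ((exp (growth p * t) - 1) / growth p) + cumul (\<lambda>z. z powr (s - 1)) y t)"
    using assms g s by (simp add: cumul_cmult cumul_add cumul_powr power_bounded_powr)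
  also have "\<dots> \<le> E * (y powr (p - 1) * (exp (growth p * t) / growth p) + y powr (s - 1) / (- growth s))"
    using assms g by (intro mult_left_mono add_mono cumul_powr_s_le divide_right_mono) auto
  finally show ?thesis by simp
qed

text \<open>Intermediate values. As \<open>y\<close> grows the available upper bound tends only to
  \<open>E * exp (- r * t)\<close>, because of the constant tail of \<open>J1\<close>; it drops
  below \<open>x\<close> once \<open>t\<close> is large.\<close>

lemma solution_exists:
  assumes "x > 0"
  shows "\<forall>\<^sub>F t in at_top. \<exists>y>0. W y t = x"
proof -
  obtain E where E: "E \<ge> 0" "\<And>z. z > 0 \<Longrightarrow> J1 z \<le> E * (z powr (q1 - 1 - 1) + z powr (1 - 1))"
    using J1_upper[of "q1 - 1"] by auto
  obtain E' where E': "E' \<ge> 0" "\<And>z. z > 0 \<Longrightarrow> J2 z \<le> E' * (z powr (q2 - 1 - 1) + z powr (s - 1))"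
    using J2_upper[of "q2 - 1"] by auto
  obtain c C where c: "c > 0" "C \<ge> 0" "\<And>z. z > 0 \<Longrightarrow> c * z powr (0 - 1) \<le> J1 z + C"
    using J1_lower[of 0] q_neg zero_le_one by metis
  have "((\<lambda>t. E * exp (- r * t)) \<longlongrightarrow> 0) at_top"
    using tendsto_mult_right_zero[OF exp_decay[OF r_pos]] .
  hence "\<forall>\<^sub>F t in at_top. E * exp (- r * t) < x" by (rule order_tendstoD) fact
  moreover have "\<forall>\<^sub>F t in at_top. (0::real) < t" by (rule eventually_gt_at_top)
  ultimately show ?thesis
  proof eventually_elim
    case (elim t)
    let ?U = "\<lambda>y. E * (y powr (q1 - 1 - 1) * exp (growth (q1 - 1) * t) + exp (- r * t)) +
      E' * (y powr (q2 - 1 - 1) * exp (growth (q2 - 1) * t) / growth (q2 - 1) + y powr (s - 1) / (- growth s))"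
    have z: "((\<lambda>y. y powr u) \<longlongrightarrow> 0) at_top" if "u < 0" for u :: real
      by (rule tendsto_neg_powr[OF that filterlim_ident])
    have "(?U \<longlongrightarrow> E * (0 * exp (growth (q1 - 1) * t) + exp (- r * t)) +
      E' * (0 * exp (growth (q2 - 1) * t) / growth (q2 - 1) + 0 / (- growth s))) at_top"
      using growth_pos[of "q2 - 1"] growth_neg[of s] q2 s q_neg
      by (intro tendsto_add tendsto_mult tendsto_divide tendsto_const z) auto
    hence "\<forall>\<^sub>F y in at_top. ?U y < x"
      by (rule order_tendstoD) (use elim in simp)
    moreover have "\<forall>\<^sub>F y in at_top. (0::real) < y" by (rule eventually_gt_at_top)
    ultimately have "\<forall>\<^sub>F y in at_top. 0 < y \<and> W y t < x"
    proof eventually_elim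
      case (elim y)
      have "smooth J1 y t + cumul J2 y t \<le> ?U y"
        by (intro add_mono smooth_J1_upper[OF E] cumul_J2_upper[OF E']) (use elim \<open>0 < t\<close> in auto)
      thus ?case using elim by (simp add: W_def)
    qed
    then obtain y1 where y1: "0 < y1" "W y1 t < x"
      using eventually_happens'[OF trivial_limit_at_top_linorder] by blast
    \<comment> \<open>The lower bound with exponent \<open>p = 0\<close>, admissible since
      \<open>q1 < 0\<close>, is a multiple of \<open>1 / y\<close>; \<open>y0\<close> makes it equal
      to \<open>x + C\<close>.\<close>
    define y0 where "y0 = c * exp (growth 0 * t) / (x + C)"
    have y0: "y0 > 0" using c assms by (simp add: y0_def)
    have "c * (y0 powr (0 - 1) * exp (growth 0 * t)) \<le> smooth J1 y0 t + C"
      by (rule smooth_J1_lower) (use c y0 elim in auto)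
    moreover have "c * (y0 powr (0 - 1) * exp (growth 0 * t)) = x + C"
      using c assms y0 by (simp add: powr_minus_divide y0_def)
    moreover have "0 \<le> cumul J2 y0 t" by (rule cumul_nonneg) (use J2_nonneg y0 in auto)
    ultimately have W0: "x \<le> W y0 t" by (simp add: W_def)
    have le: "y0 \<le> y1"
      using W_antimono[of y1 y0 t] y1 W0 elim by force
    have "\<exists>y\<ge>y0. y \<le> y1 \<and> W y t = x"
      by (rule IVT2) (use le W0 y1 y0 elim in \<open>auto intro!: DERIV_isCont[OF W_has_derivative]\<close>)
    thus ?case using y0 less_le_trans by blast
  qed
qed

text \<open>The horizon \<open>T\<close> and a solution \<open>Y\<close> run along an arbitrary
  filter. This serves twice: over all pairs of a horizon and a solution, to obtain uniqueness, and
  then for the unique solution.\<close>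

context
  fixes F :: "'b filter" and T Y :: "'b \<Rightarrow> real" and x :: real
  assumes x: "x > 0" and T: "filterlim T at_top F"
    and Y: "\<forall>\<^sub>F b in F. 0 < Y b \<and> W (Y b) (T b) = x"
begin

lemma T_pos: "\<forall>\<^sub>F b in F. 0 < T b"
  using T eventually_gt_at_top filterlim_iff by blast

lemma components_bounded:
  "\<forall>\<^sub>F b in F. 0 < T b \<and> 0 < Y b \<and> 0 \<le> smooth J1 (Y b) (T b) \<and> smooth J1 (Y b) (T b) \<le> x \<and>
     0 \<le> cumul J2 (Y b) (T b) \<and> cumul J2 (Y b) (T b) \<le> x"
  using Y T_pos
proof eventually_elim
  case (elim b)
  have "0 \<le> smooth J1 (Y b) (T b)" by (rule smooth_nonneg) (use J1_nonneg elim in auto)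
  moreover have "0 \<le> cumul J2 (Y b) (T b)" by (rule cumul_nonneg) (use J2_nonneg elim in auto)
  ultimately show ?case using elim by (auto simp: W_def)
qed

lemma exp_decay_T: "c > 0 \<Longrightarrow> ((\<lambda>b. exp (- c * T b)) \<longlongrightarrow> 0) F"
  by (rule filterlim_compose[OF exp_decay T])

lemma exp_growth_T: "c > 0 \<Longrightarrow> filterlim (\<lambda>b. exp (c * T b)) at_top F"
  by (intro filterlim_compose[OF exp_at_top] filterlim_tendsto_pos_mult_at_top[OF tendsto_const _ T])

text \<open>For \<open>p\<close> between \<open>q1\<close> and \<open>q_star\<close> the lower bound
  on \<open>J1\<close> gives \<open>c * Y powr (p - 1) * exp (growth p * T) \<le> x + C\<close> with
  \<open>growth p > 0\<close>, so \<open>Y\<close> is at least a constant times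
  \<open>exp (growth p / (1 - p) * T)\<close>.\<close>

lemma Y_at_top: "filterlim Y at_top F"
proof -
  define p where "p = (q1 + q_star r \<delta> \<theta>) / 2"
  have p: "q1 < p" "p < q_star r \<delta> \<theta>" "p \<le> 1" using q1 q_star_neg by (auto simp: p_def)
  have g: "growth p > 0" by (rule growth_pos) fact
  obtain c C where c: "c > 0" "C \<ge> 0" "\<And>z. z > 0 \<Longrightarrow> c * z powr (p - 1) \<le> J1 z + C"
    using J1_lower[OF p(1,3)] by blast
  show ?thesis
  proof (rule filterlim_at_top_mono[where f = "\<lambda>b. (c / (x + C) * exp (growth p * T b)) powr (1 / (1 - p))"])
    have "filterlim (\<lambda>b. c / (x + C) * exp (growth p * T b)) at_top F"
      using c x by (intro filterlim_tendsto_pos_mult_at_top[OF tendsto_const _ exp_growth_T[OF g]]) auto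
    thus "filterlim (\<lambda>b. (c / (x + C) * exp (growth p * T b)) powr (1 / (1 - p))) at_top F"
      using p q_star_neg by (intro filterlim_compose[OF powr_at_top]) auto
    show "\<forall>\<^sub>F b in F. (c / (x + C) * exp (growth p * T b)) powr (1 / (1 - p)) \<le> Y b"
      using components_bounded
    proof eventually_elim
      case (elim b)
      let ?e = "exp (growth p * T b)"
      have "c * (Y b powr (p - 1) * ?e) \<le> x + C"
        using smooth_J1_lower[OF c(1,3,2) p(3), of "Y b" "T b"] elim by simp
      hence "c * (Y b powr (p - 1) * ?e) * Y b powr (1 - p) \<le> (x + C) * Y b powr (1 - p)"
        by (intro mult_right_mono) auto
      moreover have "c * (Y b powr (p - 1) * ?e) * Y b powr (1 - p) = c * ?e"
      proof -
        have "Y b powr (p - 1) * Y b powr (1 - p) = 1" using elim by (simp add: powr_add[symmetric])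
        thus ?thesis by (metis (no_types) mult.assoc mult.commute mult.right_neutral)
      qed
      ultimately have "c * ?e \<le> (x + C) * Y b powr (1 - p)" by simp
      hence "c / (x + C) * ?e \<le> Y b powr (1 - p)"
        using x c by (simp add: pos_divide_le_eq mult.commute)
      hence "(c / (x + C) * ?e) powr (1 / (1 - p)) \<le> (Y b powr (1 - p)) powr (1 / (1 - p))"
        using c x p q_star_neg by (intro powr_mono2) auto
      also have "\<dots> = Y b" using elim p q_star_neg by (simp add: powr_powr)
      finally show ?case .
    qed
  qed
qed

lemma Y_powr_s: "((\<lambda>b. Y b powr (s - 1)) \<longlongrightarrow> 0) F"
  by (rule tendsto_neg_powr[OF _ Y_at_top]) (use s in simp)

text \<open>The finite difference at step \<open>u\<close> is estimated by regular variation at the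
  fixed dilation \<open>exp u\<close>. With \<open>u\<close> of both signs this bounds the
  derivative on both sides.\<close>

lemma smooth'_one_sided:
  assumes B: "exp ((q1 - 1) * u) < B" and e: "e > 0"
  shows "\<forall>\<^sub>F b in F. u * smooth' J1 (Y b) (T b) \<le> (B - 1) * smooth J1 (Y b) (T b) + e"
proof -
  \<comment> \<open>The gap below \<open>A\<close> absorbs the regular variation error, the gap
    above it the Gaussian factor \<open>?E\<close>.\<close>
  obtain A where A: "exp ((q1 - 1) * u) < A" "A < B" using dense[OF B] by blast
  have A0: "A > 0" using A(1) less_trans[OF exp_gt_zero] by blast
  have "exp u powr (q1 - 1) < A" using A(1) by (simp add: powr_def)
  then obtain C where C: "C \<ge> 0" "\<And>z. z > 0 \<Longrightarrow> J1 (exp u * z) \<le> A * J1 z + C"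
    using regvar_dilate_le[OF J1_nonneg J1_anti J1_regvar[of "exp u"], of A] by auto
  let ?E = "\<lambda>b. exp (u\<^sup>2 / (4 * a\<^sup>2 * T b))"
  have "filterlim (\<lambda>b. 4 * a\<^sup>2 * T b) at_top F"
    using a_nz by (intro filterlim_tendsto_pos_mult_at_top[OF tendsto_const _ T]) auto
  hence "((\<lambda>b. u\<^sup>2 / (4 * a\<^sup>2 * T b)) \<longlongrightarrow> 0) F"
    by (intro tendsto_divide_0[OF tendsto_const] filterlim_at_top_imp_at_infinity)
  hence E: "(?E \<longlongrightarrow> 1) F" using tendsto_exp by fastforce
  have "((\<lambda>b. ?E b * A) \<longlongrightarrow> 1 * A) F" by (intro tendsto_mult E tendsto_const)
  hence ev1: "\<forall>\<^sub>F b in F. ?E b * A < B" by (rule order_tendstoD) (use A in simp)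
  have "((\<lambda>b. ?E b * (C * exp (- r * T b))) \<longlongrightarrow> 1 * (C * 0)) F"
    by (intro tendsto_mult E tendsto_const exp_decay_T r_pos)
  hence ev2: "\<forall>\<^sub>F b in F. ?E b * (C * exp (- r * T b)) < e" by (rule order_tendstoD) (use e in simp)
  show ?thesis using ev1 ev2 components_bounded
  proof eventually_elim
    case (elim b)
    have "smooth J1 (Y b * exp u) (T b) = smooth (\<lambda>z. J1 (exp u * z)) (Y b) (T b)"
      using smooth_dilate[of J1 "exp u" "Y b" "T b"] by (simp add: mult.commute)
    also have "\<dots> \<le> smooth (\<lambda>z. A * J1 z + C) (Y b) (T b)"
      by (rule smooth_mono[OF power_bounded_dilate[OF power_bounded_J1 exp_gt_zero]
            power_bounded_add[OF power_bounded_cmult[OF power_bounded_J1] power_bounded_const]])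
        (use elim C in auto)
    also have "\<dots> = A * smooth J1 (Y b) (T b) + C * exp (- r * T b)"
      using elim by (simp add: smooth_add smooth_cmult smooth_const power_bounded_J1
        power_bounded_cmult power_bounded_const)
    finally have "?E b * smooth J1 (Y b * exp u) (T b) \<le>
        ?E b * (A * smooth J1 (Y b) (T b) + C * exp (- r * T b))"
      by (intro mult_left_mono) auto
    also have "\<dots> = (?E b * A) * smooth J1 (Y b) (T b) + ?E b * (C * exp (- r * T b))"
      by (simp add: distrib_left mult.assoc)
    also have "\<dots> \<le> B * smooth J1 (Y b) (T b) + e"
      using elim by (intro add_mono mult_right_mono) auto
    finally have "?E b * smooth J1 (Y b * exp u) (T b) \<le> B * smooth J1 (Y b) (T b) + e" .
    moreover have "u * smooth' J1 (Y b) (T b) \<le> ?E b * smooth J1 (Y b * exp u) (T b) - smooth J1 (Y b) (T b)"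
      by (rule smooth'_le_difference[OF power_bounded_J1]) (use elim J1_nonneg in auto)
    ultimately show ?case by (simp add: left_diff_distrib)
  qed
qed

lemma smooth'_asymp:
  "((\<lambda>b. smooth' J1 (Y b) (T b) + (1 - q1) * smooth J1 (Y b) (T b)) \<longlongrightarrow> 0) F"
proof (rule tendstoI)
  fix e :: real assume e: "e > 0"
  define k where "k = q1 - 1"
  \<comment> \<open>The slope error \<open>n\<close> is multiplied by a summand that never exceeds
    \<open>x\<close>, hence costs at most \<open>e / 3\<close>.\<close>
  define n where "n = e / (3 * x)"
  have n: "n > 0" "n * x = e / 3" using e x by (auto simp: n_def)
  have "((\<lambda>u. exp (k * u)) has_real_derivative k) (at 0)"
    by (auto intro!: derivative_eq_intros)
  hence "((\<lambda>u. (exp (k * u) - 1) / u) \<longlongrightarrow> k) (at 0)"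
    by (simp add: has_field_derivative_iff)
  from tendstoD[OF this n(1)] obtain d where d: "d > 0"
    "\<And>u. u \<noteq> 0 \<Longrightarrow> \<bar>u\<bar> < d \<Longrightarrow> \<bar>(exp (k * u) - 1) / u - k\<bar> < n"
    unfolding eventually_at by (auto simp: dist_real_def)
  \<comment> \<open>The step is fixed before the horizon grows. Dividing the bounds for
    \<open>u\<close> and \<open>- u\<close> by \<open>u\<close> replaces the finite difference
    factor by the slope \<open>k\<close> up to \<open>n\<close>.\<close>
  define u where "u = d / 2"
  have u: "u > 0" using d by (simp add: u_def)
  have "(exp (k * u) - 1) / u < k + n" using d(2)[of u] u d by (auto simp: u_def abs_less_iff)
  hence "exp (k * u) < 1 + u * (k + n)" using u by (simp add: field_simps)
  from smooth'_one_sided[OF this[unfolded k_def], of "u * (e / 3)"]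
  have ev1: "\<forall>\<^sub>F b in F. u * smooth' J1 (Y b) (T b) \<le> u * ((k + n) * smooth J1 (Y b) (T b) + e / 3)"
    using u e by (simp add: k_def algebra_simps)
  have "k - n < (exp (k * (-u)) - 1) / (-u)" using d(2)[of "-u"] u d by (auto simp: u_def abs_less_iff)
  hence "exp (k * (-u)) < 1 + (-u) * (k - n)" using u by (simp add: field_simps)
  from smooth'_one_sided[OF this[unfolded k_def], of "u * (e / 3)"]
  have ev2: "\<forall>\<^sub>F b in F. u * ((k - n) * smooth J1 (Y b) (T b) - e / 3) \<le> u * smooth' J1 (Y b) (T b)"
    using u e by (simp add: k_def algebra_simps)
  show "\<forall>\<^sub>F b in F. dist (smooth' J1 (Y b) (T b) + (1 - q1) * smooth J1 (Y b) (T b)) 0 < e"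
    using ev1 ev2 components_bounded
  proof eventually_elim
    case (elim b)
    let ?S = "smooth J1 (Y b) (T b)" and ?S' = "smooth' J1 (Y b) (T b)"
    have "?S' \<le> (k + n) * ?S + e / 3" "(k - n) * ?S - e / 3 \<le> ?S'" using elim(1,2) u by auto
    hence "?S' + (1 - q1) * ?S \<le> n * ?S + e / 3" "- (n * ?S + e / 3) \<le> ?S' + (1 - q1) * ?S"
      by (auto simp: k_def algebra_simps)
    moreover have "n * ?S \<le> n * x" using elim n by (intro mult_left_mono) auto
    ultimately show ?case using n e by (simp add: dist_real_def abs_less_iff)
  qed
qed

text \<open>Of the two errors in \<open>h_approx\<close>, the one relative to \<open>J2\<close>
  cumulates to at most \<open>n * x\<close>, and the power one vanishes because \<open>Y\<close>
  tends to infinity.\<close>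

lemma cumul_h_asymp:
  "((\<lambda>b. cumul h (Y b) (T b) - (1 - q2) * cumul J2 (Y b) (T b)) \<longlongrightarrow> 0) F"
proof (rule tendstoI)
  fix e :: real assume e: "e > 0"
  define n where "n = e / (2 * x)"
  have n: "n > 0" "n * x = e / 2" using e x by (auto simp: n_def)
  obtain C where C: "C \<ge> 0" "\<And>z. z > 0 \<Longrightarrow> \<bar>h z - (1 - q2) * J2 z\<bar> \<le> n * J2 z + C * z powr (s - 1)"
    using h_approx[OF n(1)] by blast
  have g: "growth s < 0" using growth_neg s by simp
  have "((\<lambda>b. C * (Y b powr (s - 1) / (- growth s))) \<longlongrightarrow> C * (0 / (- growth s))) F"
    using g by (intro tendsto_intros Y_powr_s) auto
  hence "\<forall>\<^sub>F b in F. C * (Y b powr (s - 1) / (- growth s)) < e / 2"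
    by (rule order_tendstoD) (use e in simp)
  thus "\<forall>\<^sub>F b in F. dist (cumul h (Y b) (T b) - (1 - q2) * cumul J2 (Y b) (T b)) 0 < e"
    using components_bounded
  proof eventually_elim
    case (elim b)
    let ?P = "\<lambda>z. z powr (s - 1)"
    let ?c = "\<lambda>f. cumul f (Y b) (T b)"
    have P: "power_bounded ?P" by (rule power_bounded_powr) (use s in simp)
    note pb = power_bounded_J2 power_bounded_h P power_bounded_cmult power_bounded_add
    have lin: "?c (\<lambda>z. k * J2 z + C * ?P z) = k * ?c J2 + C * ?c ?P" for k
      using elim pb by (simp add: cumul_add cumul_cmult)
    have lin': "?c (\<lambda>z. h z + C * ?P z) = ?c h + C * ?c ?P"
      using elim pb by (simp add: cumul_add cumul_cmult)
    have 1: "?c h \<le> ?c (\<lambda>z. (1 - q2 + n) * J2 z + C * ?P z)"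
      using elim C(2) by (intro cumul_mono pb) (auto simp: abs_le_iff algebra_simps)
    have 2: "?c (\<lambda>z. (1 - q2 - n) * J2 z) \<le> ?c (\<lambda>z. h z + C * ?P z)"
    proof (rule cumul_mono)
      fix z :: real assume z: "z > 0"
      show "(1 - q2 - n) * J2 z \<le> h z + C * ?P z"
        using C(2)[OF z] by (simp add: abs_le_iff algebra_simps)
    qed (use elim pb in auto)
    have 3: "C * ?c ?P \<le> C * (Y b powr (s - 1) / (- growth s))"
      using elim C by (intro mult_left_mono cumul_powr_s_le) auto
    have 4: "n * ?c J2 \<le> n * x" using elim n by (intro mult_left_mono) auto
    have "?c h \<le> (1 - q2) * ?c J2 + n * ?c J2 + C * ?c ?P"
      using 1 unfolding lin by (simp add: algebra_simps)
    moreover have "(1 - q2) * ?c J2 - n * ?c J2 \<le> ?c h + C * ?c ?P"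
      using 2 unfolding lin' cumul_cmult by (simp add: algebra_simps)
    ultimately have "\<bar>?c h - (1 - q2) * ?c J2\<bar> < e" using 3 4 elim(1) n(2) by linarith
    thus ?case by (simp add: dist_real_def)
  qed
qed

text \<open>Since \<open>growth q / (1 - q)\<close> is strictly decreasing, the power with the smaller exponent dominates.\<close>

lemma power_compare:
  assumes "p < q" "q < 1" and b: "\<forall>\<^sub>F b in F. Y b powr (p - 1) * exp (growth p * T b) \<le> M"
  shows "((\<lambda>b. Y b powr (q - 1) * exp (growth q * T b)) \<longlongrightarrow> 0) F"
proof -
  \<comment> \<open>The power \<open>m\<close> turns \<open>Y powr (p - 1)\<close> into
    \<open>Y powr (q - 1)\<close>; the exponential mismatch is \<open>exp (- d * T)\<close>, and
    \<open>d > 0\<close> is \<open>growth_ratio_less\<close>.\<close>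
  define m where "m = (1 - q) / (1 - p)"
  have m: "m > 0" "(p - 1) * m = q - 1" using assms by (auto simp: m_def field_simps)
  define d where "d = growth p * m - growth q"
  have "growth q / (1 - q) * (1 - q) < growth p / (1 - p) * (1 - q)"
    using assms growth_ratio_less by (intro mult_strict_right_mono) auto
  hence d: "d > 0" using assms by (simp add: d_def m_def)
  have "((\<lambda>b. M powr m * exp (- d * T b)) \<longlongrightarrow> M powr m * 0) F"
    by (intro tendsto_intros exp_decay_T d)
  hence lim: "((\<lambda>b. M powr m * exp (- d * T b)) \<longlongrightarrow> 0) F" by simp
  show ?thesis
  proof (rule real_tendsto_sandwich[OF _ _ tendsto_const lim])
    show "\<forall>\<^sub>F n in F. Y n powr (q - 1) * exp (growth q * T n) \<le> M powr m * exp (- d * T n)"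
      using b components_bounded
    proof eventually_elim
      case (elim b)
      have "(Y b powr (p - 1) * exp (growth p * T b)) powr m = Y b powr (q - 1) * exp (growth p * m * T b)"
        using elim m(2) by (simp add: powr_mult powr_powr exp_powr_real mult_ac)
      moreover have "(Y b powr (p - 1) * exp (growth p * T b)) powr m \<le> M powr m"
        using elim m by (intro powr_mono2) auto
      ultimately have "Y b powr (q - 1) * exp (growth p * m * T b) * exp (- d * T b) \<le> M powr m * exp (- d * T b)"
        by (intro mult_right_mono) auto
      moreover have "exp (growth p * m * T b) * exp (- d * T b) = exp (growth q * T b)"
        by (simp add: exp_add[symmetric] d_def algebra_simps)
      ultimately show ?case by (simp only: mult.assoc)
    qed
  qed (auto intro!: always_eventually)
qed

lemma cumul_J2_vanishes:
  assumes "q1 < q2" shows "((\<lambda>b. cumul J2 (Y b) (T b)) \<longlongrightarrow> 0) F"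
proof -
  \<comment> \<open>Thirds of the gap: \<open>p > q1\<close> permits the lower bound on
    \<open>J1\<close>, \<open>p' < q2\<close> the upper bound on \<open>J2\<close>, and
    \<open>p < p'\<close> the comparison. The terminal part, bounded by \<open>x\<close>, thus
    forces the consumption part to vanish.\<close>
  define p p' where "p = q1 + (q2 - q1) / 3" and "p' = q1 + 2 * (q2 - q1) / 3"
  have p: "q1 < p" "p < p'" "p' < q2" "p \<le> 1" "p' < 1" "p' < q_star r \<delta> \<theta>"
    using assms q_neg q2 unfolding p_def p'_def by (auto simp: field_simps)
  obtain c C where c: "c > 0" "C \<ge> 0" "\<And>z. z > 0 \<Longrightarrow> c * z powr (p - 1) \<le> J1 z + C"
    using J1_lower[OF p(1,4)] by blast
  obtain E where E: "E \<ge> 0" "\<And>z. z > 0 \<Longrightarrow> J2 z \<le> E * (z powr (p' - 1) + z powr (s - 1))"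
    using J2_upper[OF p(3)] by blast
  have "\<forall>\<^sub>F b in F. Y b powr (p - 1) * exp (growth p * T b) \<le> (x + C) / c"
    using components_bounded
  proof eventually_elim
    case (elim b)
    have "c * (Y b powr (p - 1) * exp (growth p * T b)) \<le> x + C"
      using smooth_J1_lower[OF c(1,3,2) p(4), of "Y b" "T b"] elim by simp
    thus ?case using c by (simp add: field_simps)
  qed
  note cmp = power_compare[OF p(2,5) this]
  have g: "growth p' > 0" "growth s < 0" using growth_pos growth_neg p s by auto
  have "((\<lambda>b. E * (Y b powr (p' - 1) * exp (growth p' * T b) / growth p' + Y b powr (s - 1) / (- growth s))) \<longlongrightarrow>
     E * (0 / growth p' + 0 / (- growth s))) F"
    using g by (intro tendsto_mult[OF tendsto_const] tendsto_add tendsto_divide cmp Y_powr_s tendsto_const) auto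
  hence lim: "((\<lambda>b. E * (Y b powr (p' - 1) * exp (growth p' * T b) / growth p' + Y b powr (s - 1) / (- growth s))) \<longlongrightarrow> 0) F"
    by simp
  show ?thesis
  proof (rule real_tendsto_sandwich[OF _ _ tendsto_const lim])
    show "\<forall>\<^sub>F b in F. 0 \<le> cumul J2 (Y b) (T b)"
      using components_bounded by eventually_elim simp
    show "\<forall>\<^sub>F b in F. cumul J2 (Y b) (T b) \<le>
        E * (Y b powr (p' - 1) * exp (growth p' * T b) / growth p' + Y b powr (s - 1) / (- growth s))"
      using components_bounded
      by eventually_elim (rule cumul_J2_upper[OF E p(3)], auto)
  qed
qed

lemma smooth_J1_vanishes:
  assumes "q2 < q1" shows "((\<lambda>b. smooth J1 (Y b) (T b)) \<longlongrightarrow> 0) F"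
proof -
  define p p' where "p = q2 + (q1 - q2) / 3" and "p' = q2 + 2 * (q1 - q2) / 3"
  have p: "q2 < p" "p < p'" "p' < q1" "p \<le> 1" "p' < 1" "p < q_star r \<delta> \<theta>"
    using assms q_neg q1 unfolding p_def p'_def by (auto simp: field_simps)
  obtain c C where c: "c > 0" "C \<ge> 0" "\<And>z. z > 0 \<Longrightarrow> c * z powr (p - 1) \<le> J2 z + C"
    using J2_lower[OF p(1,4)] by blast
  obtain E where E: "E \<ge> 0" "\<And>z. z > 0 \<Longrightarrow> J1 z \<le> E * (z powr (p' - 1) + z powr (1 - 1))"
    using J1_upper[OF p(3)] by blast
  have g: "growth p > 0" using growth_pos p by simp
  \<comment> \<open>Then \<open>?e - 1\<close> is at least \<open>?e / 2\<close>, which removes the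
    lower endpoint term of the time integral.\<close>
  have "\<forall>\<^sub>F b in F. 2 \<le> exp (growth p * T b)"
    using exp_growth_T[OF g] by (simp add: filterlim_at_top)
  hence "\<forall>\<^sub>F b in F. Y b powr (p - 1) * exp (growth p * T b) \<le> 2 * growth p * ((x + C / r) / c)"
    using components_bounded
  proof eventually_elim
    case (elim b)
    let ?e = "exp (growth p * T b)"
    have "c * (Y b powr (p - 1) * (?e / (2 * growth p))) \<le> c * (Y b powr (p - 1) * ((?e - 1) / growth p))"
      using c g elim by (intro mult_left_mono) (auto simp: field_simps)
    also have "\<dots> \<le> x + C / r"
      using cumul_J2_lower[OF c(1,3,2) p(6), of "Y b" "T b"] elim by simp
    finally show ?case using c g by (simp add: field_simps)
  qed
  note cmp = power_compare[OF p(2,5) this]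
  have "((\<lambda>b. E * (Y b powr (p' - 1) * exp (growth p' * T b) + exp (- r * T b))) \<longlongrightarrow> E * (0 + 0)) F"
    by (intro tendsto_mult[OF tendsto_const] tendsto_add cmp exp_decay_T r_pos)
  hence lim: "((\<lambda>b. E * (Y b powr (p' - 1) * exp (growth p' * T b) + exp (- r * T b))) \<longlongrightarrow> 0) F"
    by simp
  show ?thesis
  proof (rule real_tendsto_sandwich[OF _ _ tendsto_const lim])
    show "\<forall>\<^sub>F b in F. 0 \<le> smooth J1 (Y b) (T b)"
      using components_bounded by eventually_elim simp
    show "\<forall>\<^sub>F b in F. smooth J1 (Y b) (T b) \<le>
        E * (Y b powr (p' - 1) * exp (growth p' * T b) + exp (- r * T b))"
      using components_bounded
      by eventually_elim (rule smooth_J1_upper[OF E p(3)], auto)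
  qed
qed

text \<open>The quantity is minus \<open>y\<close> times the derivative of \<open>W\<close>. Since
  the summands add up to \<open>x\<close>, replacing \<open>1 - q1\<close> and \<open>1 - q2\<close>
  by the common weight \<open>1 - min q1 q2\<close> costs terms whose coefficient is 0 or whose
  summand vanishes.\<close>

lemma derivative_asymp:
  "((\<lambda>b. cumul h (Y b) (T b) - smooth' J1 (Y b) (T b)) \<longlongrightarrow> (1 - min q1 q2) * x) F"
proof -
  let ?S = "\<lambda>b. smooth J1 (Y b) (T b)" and ?S' = "\<lambda>b. smooth' J1 (Y b) (T b)"
  let ?c = "\<lambda>f b. cumul f (Y b) (T b)"
  have "((\<lambda>b. (q1 - min q1 q2) * ?S b) \<longlongrightarrow> 0) F"
  proof (cases "q2 < q1")
    case True
    show ?thesis using tendsto_mult_right_zero[OF smooth_J1_vanishes[OF True]] .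
  next
    case False
    hence "q1 - min q1 q2 = 0" by simp
    thus ?thesis by simp
  qed
  moreover have "((\<lambda>b. (q2 - min q1 q2) * ?c J2 b) \<longlongrightarrow> 0) F"
  proof (cases "q1 < q2")
    case True
    show ?thesis using tendsto_mult_right_zero[OF cumul_J2_vanishes[OF True]] .
  next
    case False
    hence "q2 - min q1 q2 = 0" by simp
    thus ?thesis by simp
  qed
  ultimately have "((\<lambda>b. (1 - min q1 q2) * x + (?c h b - (1 - q2) * ?c J2 b) - (?S' b + (1 - q1) * ?S b)
     - (q1 - min q1 q2) * ?S b - (q2 - min q1 q2) * ?c J2 b) \<longlongrightarrow> (1 - min q1 q2) * x + 0 - 0 - 0 - 0) F"
    by (intro tendsto_diff tendsto_add tendsto_const cumul_h_asymp smooth'_asymp)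
  moreover have "\<forall>\<^sub>F b in F. (1 - min q1 q2) * x + (?c h b - (1 - q2) * ?c J2 b) - (?S' b + (1 - q1) * ?S b)
     - (q1 - min q1 q2) * ?S b - (q2 - min q1 q2) * ?c J2 b = ?c h b - ?S' b"
    using Y
  proof eventually_elim
    case (elim b)
    hence "x = ?S b + ?c J2 b" by (simp add: W_def)
    thus ?case by (simp add: algebra_simps)
  qed
  ultimately show ?thesis by (auto intro: Lim_transform_eventually)
qed

end

text \<open>\<open>W\<close> is only weakly monotone by itself; injectivity comes from the asymptotics, which force a
  negative derivative at every solution once \<open>t\<close> is large.\<close>

lemma solution_unique:
  assumes x: "x > 0"
  shows "\<forall>\<^sub>F t in at_top. \<exists>!y. y > 0 \<and> W y t = x"
proof -
  \<comment> \<open>Eventually along \<open>F\<close> means: for all large \<open>t\<close>,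
    simultaneously for every solution \<open>y\<close> at \<open>t\<close>.\<close>
  define F :: "(real \<times> real) filter" where
    "F = inf (filtercomap fst at_top) (principal {(t, y). 0 < y \<and> W y t = x})"
  have "filterlim fst at_top F"
    unfolding F_def by (rule filterlim_mono[OF filterlim_filtercomap order_refl inf_le1])
  moreover have "\<forall>\<^sub>F b in F. 0 < snd b \<and> W (snd b) (fst b) = x"
    unfolding F_def eventually_inf_principal by (rule always_eventually) auto
  ultimately have "((\<lambda>b. cumul h (snd b) (fst b) - smooth' J1 (snd b) (fst b)) \<longlongrightarrow> (1 - min q1 q2) * x) F"
    by (rule derivative_asymp[OF x])
  moreover have "(1 - min q1 q2) * x > 0" using x q_neg by (intro mult_pos_pos) auto
  ultimately have "\<forall>\<^sub>F b in F. 0 < cumul h (snd b) (fst b) - smooth' J1 (snd b) (fst b)"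
    by (rule order_tendstoD)
  then obtain P where P: "eventually P at_top" and
    pos: "\<And>t y. P t \<Longrightarrow> 0 < y \<Longrightarrow> W y t = x \<Longrightarrow> 0 < cumul h y t - smooth' J1 y t"
    unfolding F_def eventually_inf_principal eventually_filtercomap by fastforce
  show ?thesis using solution_exists[OF x] P eventually_gt_at_top[of 0]
  proof eventually_elim
    case (elim t)
    \<comment> \<open>\<open>W\<close> drops strictly just to the right of a solution and never
      rises again, so it cannot return to \<open>x\<close> at a larger \<open>y'\<close>.\<close>
    have no: False if y: "0 < y" "W y t = x" "y < y'" "W y' t = x" for y y'
    proof -
      have "(smooth' J1 y t - cumul h y t) / y < 0"
        using pos[OF elim(2) y(1,2)] y by (simp add: divide_neg_pos)
      from DERIV_neg_dec_right[OF W_has_derivative[OF y(1) elim(3)] this]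
      obtain d where d: "d > 0" "\<And>e. 0 < e \<Longrightarrow> e < d \<Longrightarrow> W (y + e) t < W y t" by auto
      define e where "e = min (d / 2) (y' - y)"
      have e: "0 < e" "e < d" "y + e \<le> y'" using d y by (auto simp: e_def)
      have "W y' t \<le> W (y + e) t" by (rule W_antimono) (use e y elim in auto)
      with d(2)[OF e(1,2)] y show False by linarith
    qed
    from elim(1) obtain y where "y > 0" "W y t = x" by blast
    thus ?case using no by (metis linorder_neqE_linordered_idom)
  qed
qed

lemma solution_derivative_asymp:
  assumes x: "x > 0"
  shows "((\<lambda>t. cumul h (THE y. y > 0 \<and> W y t = x) t - smooth' J1 (THE y. y > 0 \<and> W y t = x) t)
    \<longlongrightarrow> (1 - min q1 q2) * x) at_top"
    and "\<forall>\<^sub>F t in at_top. 0 < (THE y. y > 0 \<and> W y t = x)"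
proof -
  have ev: "\<forall>\<^sub>F t in at_top. 0 < (THE y. y > 0 \<and> W y t = x) \<and> W (THE y. y > 0 \<and> W y t = x) t = x"
    using solution_unique[OF x] by eventually_elim (rule theI')
  thus "\<forall>\<^sub>F t in at_top. 0 < (THE y. y > 0 \<and> W y t = x)" by eventually_elim simp
  show "((\<lambda>t. cumul h (THE y. y > 0 \<and> W y t = x) t - smooth' J1 (THE y. y > 0 \<and> W y t = x) t)
    \<longlongrightarrow> (1 - min q1 q2) * x) at_top"
    by (rule derivative_asymp[OF x filterlim_ident ev])
qed

end

section \<open>From the utilities to the abstract marginals\<close>

theorem theorem2p8:
  fixes r \<delta> \<mu> \<sigma> \<theta> q1 q2 :: real
    and U1 U2 V1 V2 :: "real \<Rightarrow> real"
  assumes "r > 0" and "\<delta> > 0" and "\<mu> > 0" and "\<sigma> > 0"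
    and "\<theta> = sharpe r \<mu> \<sigma>" and "\<theta> \<noteq> 0"
    and "utility U1" and "utility U2"
    and "V1 = dual_fun U1" and "V2 = dual_fun U2"
    and "q1 < q_star r \<delta> \<theta>" and "q2 < q_star r \<delta> \<theta>"
    and V1_C1: "V1 C1_differentiable_on {0<..}"
    and V1_regvar: "\<And>x. x > 0 \<Longrightarrow>
          ((\<lambda>y. deriv V1 (x * y) / deriv V1 y) \<longlongrightarrow> x powr (q1 - 1)) (at_right 0)"
    and V2_C2: "V2 C1_differentiable_on {0<..}" "deriv V2 C1_differentiable_on {0<..}"
    and V2_elasticity:
          "((\<lambda>y. - (y * deriv (deriv V2) y / deriv V2 y)) \<longlongrightarrow> 1 - q2) (at_right 0)"
    and V2_growth:
          "\<exists>qb K. max (max q1 q2) 0 < qb \<and> qb < 1 \<and> K > 0 \<and>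
             (\<forall>y\<ge>1. y * deriv (deriv V2) y \<le> K * y powr (qb - 1))"
    and ratio: "q1 = q2 \<Longrightarrow>
          \<exists>k::ereal. 0 \<le> k \<and> ((\<lambda>y. ereal (deriv V2 y / deriv V1 y)) \<longlongrightarrow> k) (at_right 0)"
    and "x > 0"
  shows "((\<lambda>t. risky_amount r \<delta> \<mu> \<sigma> U1 U2 x t) \<longlongrightarrow> \<theta> / \<sigma> * (1 - min q1 q2) * x) at_top"
proof -
  \<comment> \<open>Absolute values instead of negated derivatives agree with \<open>I_fun\<close>
    at every real argument, so the identity with \<open>v_y\<close> below needs no side
    condition.\<close>
  define J1 where "J1 z = \<bar>deriv V1 z\<bar>" for z
  define J2 where "J2 z = \<bar>deriv V2 z\<bar>" for z
  define h where "h z = z * deriv (deriv V2) z" for z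
  have d1: "(dual_fun U1 has_real_derivative deriv V1 z) (at z)" if "z > 0" for z
    using C1_imp_deriv(1)[OF V1_C1] that \<open>V1 = _\<close> by simp
  have d2: "(dual_fun U2 has_real_derivative deriv V2 z) (at z)" if "z > 0" for z
    using C1_imp_deriv(1)[OF V2_C2(1)] that \<open>V2 = _\<close> by simp
  have d22: "(deriv V2 has_real_derivative deriv (deriv V2) z) (at z)" if "z > 0" for z
    using C1_imp_deriv(1)[OF V2_C2(2)] that by simp
  have neg: "deriv V1 z \<le> 0" "deriv V2 z \<le> 0" if "z > 0" for z
    using dual_fun_deriv_nonpos[OF \<open>utility U1\<close> d1 that] dual_fun_deriv_nonpos[OF \<open>utility U2\<close> d2 that] that
    by auto
  have J1_eq: "J1 z = - deriv V1 z" and J2_eq: "J2 z = - deriv V2 z" if "z > 0" for z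
    using neg[OF that] by (auto simp: J1_def J2_def)
  have mono: "deriv V1 y \<le> deriv V1 z" "deriv V2 y \<le> deriv V2 z" if "0 < y" "y \<le> z" for y z
    using dual_fun_deriv_mono[OF \<open>utility U1\<close> d1 d1, of y z]
      dual_fun_deriv_mono[OF \<open>utility U2\<close> d2 d2, of y z] that by auto
  have J2_deriv: "(J2 has_real_derivative - (h z / z)) (at z)" if "z > 0" for z
  proof (rule has_field_derivative_transform_within_open[where f = "\<lambda>z. - deriv V2 z" and S = "{0<..}"])
    show "((\<lambda>z. - deriv V2 z) has_real_derivative - (h z / z)) (at z)"
      using DERIV_minus[OF d22[OF that]] that by (simp add: h_def)
  qed (use that J2_eq in auto)
  obtain qb K where K: "max (max q1 q2) 0 < qb" "qb < 1" "K > 0"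
    "\<And>y. y \<ge> 1 \<Longrightarrow> h y \<le> K * y powr (qb - 1)" using V2_growth unfolding h_def by blast
  have J2_lim: "(J2 \<longlongrightarrow> 0) at_top"
  proof -
    have "(deriv V2 \<longlongrightarrow> 0) at_top" by (rule dual_fun_deriv_tendsto_0[OF \<open>utility U2\<close> d2])
    thus ?thesis unfolding J2_def[abs_def] by (rule tendsto_rabs_zero)
  qed
  \<comment> \<open>\<open>K / (1 - qb)\<close> is the constant produced by
    \<open>tail_bound\<close> from the growth condition on \<open>h\<close>.\<close>
  interpret dual_marginals r \<delta> \<theta> J1 J2 h q1 q2 qb "K / (1 - qb)" K
  proof (unfold_locales)
    show "continuous_on {0<..} J1"
      unfolding J1_def[abs_def] by (intro continuous_intros C1_imp_deriv(2)[OF V1_C1])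
    show "((\<lambda>y. J1 (x * y) / J1 y) \<longlongrightarrow> x powr (q1 - 1)) (at_right 0)" if "x > 0" for x
    proof (rule Lim_transform_eventually[OF V1_regvar[OF that]])
      show "\<forall>\<^sub>F y in at_right 0. deriv V1 (x * y) / deriv V1 y = J1 (x * y) / J1 y"
        using eventually_at_right_less by eventually_elim (use that in \<open>simp add: J1_eq\<close>)
    qed
    show "((\<lambda>y. h y / J2 y) \<longlongrightarrow> 1 - q2) (at_right 0)"
    proof (rule Lim_transform_eventually[OF V2_elasticity])
      show "\<forall>\<^sub>F y in at_right 0. - (y * deriv (deriv V2) y / deriv V2 y) = h y / J2 y"
        using eventually_at_right_less by eventually_elim (simp add: J2_eq h_def)
    qed
    show "continuous_on {0<..} h"
      unfolding h_def[abs_def] by (intro continuous_intros C1_imp_deriv(2)[OF V2_C2(2)])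
    show "0 \<le> h z" if "0 < z" for z
    proof -
      have "deriv (deriv V2) z \<ge> 0"
      proof (rule ccontr)
        assume "\<not> ?thesis"
        with DERIV_neg_dec_right[OF d22[OF that]] obtain d where
          d: "d > 0" "\<And>e. 0 < e \<Longrightarrow> e < d \<Longrightarrow> deriv V2 (z + e) < deriv V2 z" by force
        show False using d(2)[of "d / 2"] d(1) mono(2)[of z "z + d / 2"] that by auto
      qed
      thus ?thesis using that by (simp add: h_def)
    qed
    show "J2 z \<le> K / (1 - qb) * z powr (qb - 1)" if "1 \<le> z" for z
      by (rule tail_bound[OF _ _ _ J2_lim that, of h]) (use J2_deriv K in auto)
    show "J1 z' \<le> J1 z" "J2 z' \<le> J2 z" if "0 < z" "z \<le> z'" for z z'
      using mono[OF that] that J1_eq J2_eq by auto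
  qed (use assms(1-12) K J2_deriv in \<open>auto simp: J1_def J2_def\<close>)
  define y where "y t = (THE y. y > 0 \<and> W y t = x)" for t
  have v_y: "v_y r \<delta> \<theta> V1 V2 z t = - W z t" for z t
  proof -
    have "(\<lambda>z. \<bar>deriv V1 z\<bar>) = J1" "(\<lambda>z. \<bar>deriv V2 z\<bar>) = J2" by (auto simp: J1_def J2_def)
    thus ?thesis by (simp add: v_y_def I_fun_eq W_def cumul_def)
  qed
  have y_sol: "y_sol r \<delta> \<theta> V1 V2 x t = y t" for t
    unfolding y_sol_def v_y y_def by (simp add: eq_commute)
  have "\<forall>\<^sub>F t in at_top. \<theta> / \<sigma> * (cumul h (y t) t - smooth' J1 (y t) t) = risky_amount r \<delta> \<mu> \<sigma> U1 U2 x t"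
    using solution_derivative_asymp(2)[OF \<open>x > 0\<close>] eventually_gt_at_top[of 0]
  proof eventually_elim
    case (elim t)
    have "((\<lambda>z. v_y r \<delta> \<theta> V1 V2 z t) has_real_derivative - ((smooth' J1 (y t) t - cumul h (y t) t) / y t)) (at (y t))"
      unfolding v_y by (rule DERIV_minus[OF W_has_derivative]) (use elim in \<open>auto simp: y_def\<close>)
    hence "v_yy r \<delta> \<theta> V1 V2 (y t) t = - ((smooth' J1 (y t) t - cumul h (y t) t) / y t)"
      unfolding v_yy_def by (rule DERIV_imp_deriv)
    hence "y t * v_yy r \<delta> \<theta> V1 V2 (y t) t = cumul h (y t) t - smooth' J1 (y t) t"
      using elim by (simp add: y_def)
    moreover have "risky_amount r \<delta> \<mu> \<sigma> U1 U2 x t = \<theta> / \<sigma> * (y t * v_yy r \<delta> \<theta> V1 V2 (y t) t)"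
      using y_sol[of t] by (simp add: risky_amount_def Let_def assms(5,9,10) mult.assoc)
    ultimately show ?case by simp
  qed
  moreover have "((\<lambda>t. \<theta> / \<sigma> * (cumul h (y t) t - smooth' J1 (y t) t)) \<longlongrightarrow> \<theta> / \<sigma> * ((1 - min q1 q2) * x)) at_top"
    unfolding y_def by (intro tendsto_mult tendsto_const solution_derivative_asymp(1) \<open>x > 0\<close>)
  ultimately show ?thesis
    by (auto intro: Lim_transform_eventually simp: mult.assoc)
qed

end
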